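(* Let $N\ge 1$ be an integer, $p>1$ and $1<q<\frac{2p}{p+1}$. There exists a constant $c_{N,p,q}>0$, depending only on $N,p,q$, such that the following holds. For any $M>0$ there is a constant $C=C(N,M,p,q)>0$ such that, for all $x_0\in\mathbb{R}^N$ and $R,T>0$, every nonnegative solution $u$ of $$u_t-\Delta u=u^p+M|\nabla u|^q\quad\text{in } Q_{T,R}$$ satisfying $$u\le c_{N,p,q}\,M^{\frac{2}{2p-(p+1)q}}\quad\text{and}\quad u_t\le 0\quad\text{in } Q_{T,R}$$ satisfies $$|\nabla u(x,t)|\le C\left(R^{-1}+R^{-\frac{1}{q-1}}+t^{-\frac1q}\right)\quad\text{in } Q_{T,R/2}.$$
   Context: For $x_0\in\mathbb{R}^N$ and $R,T>0$, $Q_{T,R}=B(x_0,R)\times(0,T)$, where $B(x_0,R)$ is the open ball of $\mathbb{R}^N$; $Q_{T,R/2}$ has the same center $x_0$. The operators $\nabla$ and $\Delta$ act only on the spatial variable $x$. A solution is a classical solution, i.e. it belongs to $C^{2,1}(Q_{T,R})$ ($C^2$ in $x$, $C^1$ in $t$). *)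

theory Defs
  imports "HOL-Analysis.Analysis"
begin

text \<open>Functions of space and time are curried: \<open>u x t\<close> with \<open>x\<close> in \<open>real ^ 'n\<close>, so that the
  space dimension is \<open>CARD('n)\<close>.\<close>

definition cylinder :: "real ^ 'n \<Rightarrow> real \<Rightarrow> real \<Rightarrow> ((real ^ 'n) \<times> real) set" where
  "cylinder x0 R T = ball x0 R \<times> {0<..<T}"

definition space_deriv ::
  "'n \<Rightarrow> (real ^ 'n \<Rightarrow> real \<Rightarrow> real) \<Rightarrow> real ^ 'n \<Rightarrow> real \<Rightarrow> real" where
  "space_deriv i u x t = deriv (\<lambda>s. u (x + s *\<^sub>R axis i 1) t) 0"

definition time_deriv ::
  "(real ^ 'n \<Rightarrow> real \<Rightarrow> real) \<Rightarrow> real ^ 'n \<Rightarrow> real \<Rightarrow> real" where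
  "time_deriv u x t = deriv (u x) t"

definition space_grad ::
  "(real ^ 'n \<Rightarrow> real \<Rightarrow> real) \<Rightarrow> real ^ 'n \<Rightarrow> real \<Rightarrow> real ^ 'n" where
  "space_grad u x t = (\<chi> i. space_deriv i u x t)"

definition space_laplacian ::
  "(real ^ 'n \<Rightarrow> real \<Rightarrow> real) \<Rightarrow> real ^ 'n \<Rightarrow> real \<Rightarrow> real" where
  "space_laplacian u x t = (\<Sum>i\<in>UNIV. space_deriv i (space_deriv i u) x t)"

text \<open>\<open>deriv\<close> is total, so the existence of each partial derivative is required explicitly,
  besides its joint continuity in \<open>(x, t)\<close>. The definition is meant for open \<open>Q\<close>.\<close>

definition has_space_deriv_on ::
  "((real ^ 'n) \<times> real) set \<Rightarrow> 'n \<Rightarrow> (real ^ 'n \<Rightarrow> real \<Rightarrow> real) \<Rightarrow> bool" where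
  "has_space_deriv_on Q i u \<longleftrightarrow>
     (\<forall>(x, t)\<in>Q. (\<lambda>s. u (x + s *\<^sub>R axis i 1) t) field_differentiable (at 0))"

definition has_time_deriv_on ::
  "((real ^ 'n) \<times> real) set \<Rightarrow> (real ^ 'n \<Rightarrow> real \<Rightarrow> real) \<Rightarrow> bool" where
  "has_time_deriv_on Q u \<longleftrightarrow> (\<forall>(x, t)\<in>Q. u x field_differentiable (at t))"

definition C21_on ::
  "((real ^ 'n) \<times> real) set \<Rightarrow> (real ^ 'n \<Rightarrow> real \<Rightarrow> real) \<Rightarrow> bool" where
  "C21_on Q u \<longleftrightarrow>
     continuous_on Q (\<lambda>(x, t). u x t) \<and>
     has_time_deriv_on Q u \<and> continuous_on Q (\<lambda>(x, t). time_deriv u x t) \<and>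
     (\<forall>i. has_space_deriv_on Q i u \<and> continuous_on Q (\<lambda>(x, t). space_deriv i u x t)) \<and>
     (\<forall>i j. has_space_deriv_on Q j (space_deriv i u) \<and>
            continuous_on Q (\<lambda>(x, t). space_deriv j (space_deriv i u) x t))"

text \<open>Since \<open>u \<ge> 0\<close>, the real powers are those of nonnegative bases, where \<open>0 powr a = 0\<close>
  is the usual value for \<open>a > 0\<close>.\<close>

definition nonneg_classical_solution ::
  "real \<Rightarrow> real \<Rightarrow> real \<Rightarrow> ((real ^ 'n) \<times> real) set \<Rightarrow> (real ^ 'n \<Rightarrow> real \<Rightarrow> real) \<Rightarrow> bool" where
  "nonneg_classical_solution p q M Q u \<longleftrightarrow>
     C21_on Q u \<and>
     (\<forall>(x, t)\<in>Q. 0 \<le> u x t) \<and>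
     (\<forall>(x, t)\<in>Q. time_deriv u x t - space_laplacian u x t
                 = u x t powr p + M * norm (space_grad u x t) powr q)"

end

(*
  A Bernstein estimate for w = |grad u|^2. With U the upper bound for u and b = 2 U - u, the function
  D^m w / b, where D is a parabolic cutoff, is considered at its maximum. Since u_t <= 0, the Laplacian
  satisfies |Delta u| >= u^p + M |grad u|^q there, and smallness of u lets |D^2 u|^2 >= |Delta u|^2 / N
  absorb the reaction term 2 p u^(p-1) w. The weight 1 / b turns the remaining drift into the
  dissipative term (q - 1) M |grad u|^q / b, which controls all terms coming from the cutoff.
  As u is only C^{2,1}, the equation for w is not available; w is replaced by the sum of squares of
  difference quotients, and the step size tends to 0 at the maximum points.
*)

theory Submission
  imports Defs
begin


text \<open>Write g for |grad u| at the maximum point, X = 1 / (r D) and Y = 1 / (sigma D), with r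
  and sigma the radius and the length of the local cylinder. The conditions at that point reduce to
  g^q <= K ((g^(q-1) + g) X + X^2 + Y). Any of the four terms may dominate; solving for g gives X,
  X^(1/(q-1)), X^(2/q) or Y^(1/q). The third is bounded by the sum of the first two because q < 2,
  which leaves the three rates of the theorem. The negative powers of D are paid for by D^m with m =
  2 k and k >= 1/(q-1), the largest exponent; the 2 is there because w is quadratic in the gradient.
  The number 2 U in b keeps b between U and 2 U, so the weight costs only a factor 2 when values of
  w are compared. The cutoff vanishes on the lateral and initial boundary but equals 1 at the centre
  at the final time. The maximum may therefore lie at the final time, where it can be compared with
  earlier times only.\<close>

section \<open>Maximum conditions for a quotient along a line\<close>

text \<open>If \<open>f2\<close> were positive, \<open>f'\<close> would be positive just to the
  right of 0, and the mean value theorem would push \<open>f\<close> above \<open>f 0\<close>.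
  Differentiability of \<open>f'\<close> at the single point 0 suffices, which matches a second
  derivative that is merely known to exist.\<close>

lemma local_max_second_deriv:
  fixes f f' :: "real \<Rightarrow> real"
  assumes f: "\<forall>\<^sub>F s in nhds 0. (f has_real_derivative f' s) (at s)"
    and f2: "(f' has_real_derivative f2) (at 0)"
    and mx: "\<forall>\<^sub>F s in nhds 0. f s \<le> f 0"
  shows "f' 0 = 0" and "f2 \<le> 0"
proof -
  obtain d where d: "d > 0" "\<And>s. \<bar>s\<bar> < d \<Longrightarrow> (f has_real_derivative f' s) (at s) \<and> f s \<le> f 0"
    using eventually_conj[OF f mx] unfolding eventually_nhds_metric dist_real_def by auto
  show z: "f' 0 = 0"
    using DERIV_local_max[of f "f' 0" 0 d] d by simp
  show "f2 \<le> 0"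
  proof (rule ccontr)
    assume "\<not> f2 \<le> 0"
    then obtain e where e: "e > 0" "\<And>h. h > 0 \<Longrightarrow> h < e \<Longrightarrow> f' 0 < f' h"
      using DERIV_pos_inc_right[OF f2] by auto
    define h where "h = min d e / 2"
    have h: "h > 0" "h < d" "h < e" using d e by (auto simp: h_def)
    obtain c where c: "0 < c" "c < h" "f h - f 0 = (h - 0) * f' c"
      using MVT2[of 0 h f f'] d h by auto
    have "f' c > 0" using e(2)[of c] c h z by auto
    then have "f h > f 0" using c h by (smt (verit) mult_pos_pos)
    with d(2)[of h] h show False by auto
  qed
qed

lemma eventually_nhds_pos:
  fixes f :: "real \<Rightarrow> real"
  assumes "isCont f a" "f a > 0"
  shows "\<forall>\<^sub>F s in nhds a. f s > 0"
  using order_tendstoD(1)[OF assms[unfolded isCont_def]] assms(2)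
  by (simp add: eventually_nhds_conv_at)

text \<open>The logarithm of W D^m / b is maximal at the same point and turns the product into a
  sum, so each factor contributes its own logarithmic derivatives.\<close>

lemma local_max_quotient_space:
  fixes W W1 b b1 D D1 :: "real \<Rightarrow> real"
  assumes W: "\<forall>\<^sub>F s in nhds 0. (W has_real_derivative W1 s) (at s)"
      "(W1 has_real_derivative W2) (at 0)" "W 0 > 0"
    and b: "\<forall>\<^sub>F s in nhds 0. (b has_real_derivative b1 s) (at s)"
      "(b1 has_real_derivative b2) (at 0)" "b 0 > 0"
    and D: "\<forall>\<^sub>F s in nhds 0. (D has_real_derivative D1 s) (at s)"
      "(D1 has_real_derivative D2) (at 0)" "D 0 > 0"
    and mx: "\<forall>\<^sub>F s in nhds 0. W s * D s ^ m / b s \<le> W 0 * D 0 ^ m / b 0"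
  shows "W1 0 / W 0 - b1 0 / b 0 + m * D1 0 / D 0 = 0"
    and "W2 / W 0 - (W1 0 / W 0)\<^sup>2 - b2 / b 0 + (b1 0 / b 0)\<^sup>2
      + m * (D2 / D 0 - (D1 0 / D 0)\<^sup>2) \<le> 0"
proof -
  let ?f = "\<lambda>s. ln (W s) - ln (b s) + m * ln (D s)"
  let ?f1 = "\<lambda>s. W1 s / W s - b1 s / b s + m * (D1 s / D s)"
  have dW: "(W has_real_derivative W1 0) (at 0)" and db: "(b has_real_derivative b1 0) (at 0)"
    and dD: "(D has_real_derivative D1 0) (at 0)"
    using W b D eventually_nhds_x_imp_x by blast+
  have pos: "\<forall>\<^sub>F s in nhds 0. W s > 0 \<and> b s > 0 \<and> D s > 0"
    by (intro eventually_conj eventually_nhds_pos DERIV_isCont[OF dW] DERIV_isCont[OF db]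
        DERIV_isCont[OF dD] W b D)
  have 1: "\<forall>\<^sub>F s in nhds 0. (?f has_real_derivative ?f1 s) (at s)"
    using pos W(1) b(1) D(1)
    by eventually_elim (auto intro!: derivative_eq_intros simp: field_simps)
  have 2: "(?f1 has_real_derivative
      (W2 / W 0 - (W1 0 / W 0)\<^sup>2 - (b2 / b 0 - (b1 0 / b 0)\<^sup>2) + m * (D2 / D 0 - (D1 0 / D 0)\<^sup>2))) (at 0)"
    using W(3) b(3) D(3)
    by (auto intro!: derivative_eq_intros W(2) b(2) D(2) dW db dD)
       (simp add: field_simps power2_eq_square)
  have ev: "ln (x * y ^ m / z) = ln x - ln z + m * ln y" if "x > 0" "y > 0" "z > 0" for x y z :: real
    using that by (simp add: ln_div ln_mult ln_realpow)
  have 3: "\<forall>\<^sub>F s in nhds 0. ?f s \<le> ?f 0"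
    using pos mx
  proof eventually_elim
    case (elim s)
    then have "ln (W s * D s ^ m / b s) \<le> ln (W 0 * D 0 ^ m / b 0)"
      by (intro ln_mono) auto
    with elim W(3) b(3) D(3) show ?case by (simp add: ev)
  qed
  show "W1 0 / W 0 - b1 0 / b 0 + m * D1 0 / D 0 = 0"
    using local_max_second_deriv(1)[OF 1 2 3] by simp
  show "W2 / W 0 - (W1 0 / W 0)\<^sup>2 - b2 / b 0 + (b1 0 / b 0)\<^sup>2
      + m * (D2 / D 0 - (D1 0 / D 0)\<^sup>2) \<le> 0"
    using local_max_second_deriv(2)[OF 1 2 3] by simp
qed

text \<open>The maximum may sit at the final time of a closed cylinder. Comparison with earlier
  times then gives only the sign of the logarithmic derivative, and the sign is the one needed to
  bound the heat operator.\<close>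

lemma left_max_quotient_time:
  fixes W b D :: "real \<Rightarrow> real"
  assumes W: "(W has_real_derivative W1) (at a)" "W a > 0"
    and b: "(b has_real_derivative b1) (at a)" "b a > 0"
    and D: "(D has_real_derivative D1) (at a)" "D a > 0"
    and mx: "\<forall>\<^sub>F s in at_left a. W s * D s ^ m / b s \<le> W a * D a ^ m / b a"
  shows "W1 / W a - b1 / b a + m * D1 / D a \<ge> 0"
proof (rule ccontr)
  let ?f = "\<lambda>s. ln (W s) - ln (b s) + m * ln (D s)"
  let ?d = "W1 / W a - b1 / b a + m * D1 / D a"
  assume "\<not> ?d \<ge> 0"
  moreover have "(?f has_real_derivative ?d) (at a)"
    using W b D by (auto intro!: derivative_eq_intros simp: field_simps)
  ultimately obtain e where e: "e > 0" "\<And>h. h > 0 \<Longrightarrow> h < e \<Longrightarrow> ?f a < ?f (a - h)"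
    using DERIV_neg_dec_left[of ?f ?d a] by (auto simp: not_le)
  have "\<forall>\<^sub>F s in nhds a. W s > 0 \<and> b s > 0 \<and> D s > 0"
    by (intro eventually_conj eventually_nhds_pos DERIV_isCont[OF W(1)] DERIV_isCont[OF b(1)]
        DERIV_isCont[OF D(1)] W b D)
  then have "\<forall>\<^sub>F s in at_left a. W s > 0 \<and> b s > 0 \<and> D s > 0"
    by (simp add: eventually_nhds_conv_at eventually_at_split)
  moreover have "\<forall>\<^sub>F s in at_left a. s \<in> {a - e<..<a}"
    using e(1) by (intro eventually_at_leftI[of "a - e"]) auto
  ultimately have "\<forall>\<^sub>F s in at_left a. False"
    using mx
  proof eventually_elim
    case (elim s)
    have ev: "ln (x * y ^ m / z) = ln x - ln z + m * ln y" if "x > 0" "y > 0" "z > 0" for x y z :: real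
      using that by (simp add: ln_div ln_mult ln_realpow)
    have "ln (W s * D s ^ m / b s) \<le> ln (W a * D a ^ m / b a)"
      using elim by (intro ln_mono) auto
    with elim W(2) b(2) D(2) have "?f s \<le> ?f a" by (simp add: ev)
    moreover have "?f a < ?f s" using e(2)[of "a - s"] elim by auto
    ultimately show ?case by simp
  qed
  then show False by simp
qed

section \<open>Difference quotients and their limits\<close>

text \<open>\<open>space_deriv\<close> is a derivative at parameter 0 of a line through the point;
  moving the base point along the line gives the derivative at every parameter.\<close>

lemma DERIV_space_line:
  fixes x :: "real ^ 'n"
  assumes "has_space_deriv_on Q i v" "(x + s *\<^sub>R axis i 1, t) \<in> Q"
  shows "((\<lambda>s. v (x + s *\<^sub>R axis i 1) t) has_real_derivative
      space_deriv i v (x + s *\<^sub>R axis i 1) t) (at s)"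
proof -
  have "((\<lambda>h. v (x + s *\<^sub>R axis i 1 + h *\<^sub>R axis i 1) t) has_real_derivative
      space_deriv i v (x + s *\<^sub>R axis i 1) t) (at 0)"
    using assms unfolding has_space_deriv_on_def space_deriv_def
    by (auto simp: field_differentiable_derivI dest!: bspec)
  then show ?thesis
    using DERIV_shift[of "\<lambda>s. v (x + s *\<^sub>R axis i 1) t" _ 0 s]
    by (simp add: scaleR_add_left algebra_simps)
qed

lemma DERIV_time_line:
  assumes "has_time_deriv_on Q v" "(x, t) \<in> Q"
  shows "(v x has_real_derivative time_deriv v x t) (at t)"
  using assms unfolding has_time_deriv_on_def time_deriv_def
  by (auto simp: field_differentiable_derivI dest!: bspec)

definition diff_quot ::
  "real \<Rightarrow> 'n \<Rightarrow> (real ^ 'n \<Rightarrow> real \<Rightarrow> real) \<Rightarrow> real ^ 'n \<Rightarrow> real \<Rightarrow> real" where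
  "diff_quot e i v x t = (v (x + e *\<^sub>R axis i 1) t - v x t) / e"

text \<open>By the mean value theorem each quotient is a value of \<open>g\<close> at an
  intermediate point, and continuity of \<open>g\<close> does the rest. The base points vary with
  the step, because the maximum points to which this is applied do.\<close>

lemma tendsto_diff_quot:
  fixes y :: "real ^ 'n"
  assumes S: "open S" "(y, \<tau>) \<in> S"
    and der: "\<And>x t. (x, t) \<in> S \<Longrightarrow>
      ((\<lambda>s. v (x + s *\<^sub>R axis i 1) t) has_real_derivative g x t) (at 0)"
    and cont: "continuous_on S (\<lambda>(x, t). g x t)"
    and X: "X \<longlonglongrightarrow> y" and T: "T \<longlonglongrightarrow> \<tau>" and E: "E \<longlonglongrightarrow> 0" "\<And>n. E n > 0"
  shows "(\<lambda>n::nat. diff_quot (E n) i v (X n) (T n)) \<longlonglongrightarrow> g y \<tau>"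
proof (rule tendstoI)
  fix e :: real assume "e > 0"
  have "isCont (\<lambda>(x, t). g x t) (y, \<tau>)"
    using cont S continuous_on_eq_continuous_at by blast
  then obtain d1 where d1: "d1 > 0"
    "\<And>P. dist P (y, \<tau>) < d1 \<Longrightarrow> dist ((\<lambda>(x, t). g x t) P) (g y \<tau>) < e"
    using \<open>e > 0\<close> unfolding continuous_at_eps_delta by fastforce
  obtain d2 where d2: "d2 > 0" "ball (y, \<tau>) d2 \<subseteq> S"
    using S openE by blast
  define d where "d = min d1 d2"
  have d: "d > 0" using d1 d2 by (simp add: d_def)
  have "\<forall>\<^sub>F n in sequentially. dist (X n) y < d / 3"
    using X d by (intro tendstoD) auto
  moreover have "\<forall>\<^sub>F n in sequentially. dist (T n) \<tau> < d / 3"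
    using T d by (intro tendstoD) auto
  moreover have "\<forall>\<^sub>F n in sequentially. dist (E n) 0 < d / 3"
    using E d by (intro tendstoD) auto
  ultimately show "\<forall>\<^sub>F n in sequentially. dist (diff_quot (E n) i v (X n) (T n)) (g y \<tau>) < e"
  proof eventually_elim
    case (elim n)
    have near: "dist (X n + s *\<^sub>R axis i 1, T n) (y, \<tau>) < d" if "0 \<le> s" "s \<le> E n" for s
    proof -
      have "dist (X n + s *\<^sub>R axis i 1, T n) (y, \<tau>)
          \<le> dist (X n + s *\<^sub>R axis i 1) y + dist (T n) \<tau>"
        unfolding dist_Pair_Pair by (rule sqrt_sum_squares_le_sum) auto
      also have "dist (X n + s *\<^sub>R axis i 1) y \<le> dist (X n + s *\<^sub>R axis i 1) (X n) + dist (X n) y"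
        by (rule dist_triangle)
      also have "dist (X n + s *\<^sub>R axis i 1) (X n) = s"
        using that by (simp add: dist_norm)
      finally show ?thesis using elim that by simp
    qed
    have der': "((\<lambda>s. v (X n + s *\<^sub>R axis i 1) (T n)) has_real_derivative
        g (X n + s *\<^sub>R axis i 1) (T n)) (at s)" if "0 \<le> s" "s \<le> E n" for s
    proof -
      have "(X n + s *\<^sub>R axis i 1, T n) \<in> S"
        using near[OF that] d2 by (auto simp: d_def dist_commute)
      from der[OF this] show ?thesis
        using DERIV_shift[of "\<lambda>s. v (X n + s *\<^sub>R axis i 1) (T n)" _ 0 s]
        by (simp add: scaleR_add_left algebra_simps)
    qed
    have "\<exists>z>0. z < E n \<and>
      v (X n + E n *\<^sub>R axis i 1) (T n) - v (X n + 0 *\<^sub>R axis i 1) (T n)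
        = (E n - 0) * g (X n + z *\<^sub>R axis i 1) (T n)"
      by (rule MVT2) (fact E(2), fact der')
    then obtain z where z: "0 < z" "z < E n"
      "v (X n + E n *\<^sub>R axis i 1) (T n) - v (X n + 0 *\<^sub>R axis i 1) (T n)
        = (E n - 0) * g (X n + z *\<^sub>R axis i 1) (T n)"
      by blast
    then have "diff_quot (E n) i v (X n) (T n) = g (X n + z *\<^sub>R axis i 1) (T n)"
      using E(2)[of n] by (simp add: diff_quot_def)
    moreover have "dist (X n + z *\<^sub>R axis i 1, T n) (y, \<tau>) < d1"
      using near[of z] z by (simp add: d_def)
    ultimately show ?case using d1(2)[of "(X n + z *\<^sub>R axis i 1, T n)"] by simp
  qed
qed


text \<open>The discrete substitute for |grad v|^2: for a fixed step it has the regularity of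
  \<open>v\<close> itself, whereas |grad v|^2 would lose one derivative.\<close>

definition sq_diff :: "real \<Rightarrow> (real ^ 'n \<Rightarrow> real \<Rightarrow> real) \<Rightarrow> real ^ 'n \<Rightarrow> real \<Rightarrow> real" where
  "sq_diff e v x t = (\<Sum>i\<in>UNIV. (diff_quot e i v x t)\<^sup>2)"

text \<open>Taking a difference quotient commutes with differentiation, so quotients of second
  derivatives can stand where third derivatives would appear.\<close>

lemma DERIV_diff_quot_space:
  fixes x :: "real ^ 'n"
  assumes "has_space_deriv_on Q j v" "(x + s *\<^sub>R axis j 1, t) \<in> Q"
    "(x + e *\<^sub>R axis i 1 + s *\<^sub>R axis j 1, t) \<in> Q"
  shows "((\<lambda>s. diff_quot e i v (x + s *\<^sub>R axis j 1) t) has_real_derivative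
      diff_quot e i (space_deriv j v) (x + s *\<^sub>R axis j 1) t) (at s)"
  using DERIV_cdivide[OF DERIV_diff[OF DERIV_space_line[OF assms(1,3)] DERIV_space_line[OF assms(1,2)]], of e]
  unfolding diff_quot_def by (simp add: algebra_simps)

lemma DERIV_diff_quot_time:
  assumes "has_time_deriv_on Q v" "(x, t) \<in> Q" "(x + e *\<^sub>R axis i 1, t) \<in> Q"
  shows "((\<lambda>t. diff_quot e i v x t) has_real_derivative diff_quot e i (time_deriv v) x t) (at t)"
  using DERIV_cdivide[OF DERIV_diff[OF DERIV_time_line[OF assms(1,3)] DERIV_time_line[OF assms(1,2)]], of e]
  unfolding diff_quot_def by simp

lemma eventually_line_in_open:
  fixes y :: "real ^ 'n"
  assumes "open Q" "(y, \<tau>) \<in> Q"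
  shows "\<forall>\<^sub>F s in nhds 0. (y + s *\<^sub>R axis j 1, \<tau>) \<in> Q"
proof -
  have "((\<lambda>s::real. (y + s *\<^sub>R axis j 1, \<tau>)) \<longlongrightarrow> (y + 0 *\<^sub>R axis j 1, \<tau>)) (nhds 0)"
    by (intro tendsto_intros filterlim_ident)
  from topological_tendstoD[OF this assms(1)] assms(2) show ?thesis by simp
qed

section \<open>The inequality at a maximum point, for a fixed step\<close>

text \<open>This is the heat operator applied to ln W - ln (A - u) + m ln D at its maximum: the time
  derivative is nonnegative, the pure second derivatives are nonpositive, and the difference is
  rewritten with the equation for u. \<open>W1 j / sq_diff e u y \<tau>\<close> is the logarithmic
  derivative of W in direction j.\<close>

lemma bernstein_at_max:
  fixes u D F :: "real ^ 'n \<Rightarrow> real \<Rightarrow> real" and A e \<tau> :: real and m :: nat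
  assumes Q: "open Q" and u: "C21_on Q u" and D: "C21_on Q D"
    and eq: "\<And>x t. (x, t) \<in> Q \<Longrightarrow> time_deriv u x t - space_laplacian u x t = F x t"
    and P: "(y, \<tau>) \<in> Q" "\<And>i. (y + e *\<^sub>R axis i 1, \<tau>) \<in> Q"
    and pos: "sq_diff e u y \<tau> > 0" "u y \<tau> < A" "D y \<tau> > 0"
    and mx: "\<And>j. \<forall>\<^sub>F s in nhds 0.
        sq_diff e u (y + s *\<^sub>R axis j 1) \<tau> * D (y + s *\<^sub>R axis j 1) \<tau> ^ m / (A - u (y + s *\<^sub>R axis j 1) \<tau>)
        \<le> sq_diff e u y \<tau> * D y \<tau> ^ m / (A - u y \<tau>)"
      "\<forall>\<^sub>F s in at_left \<tau>. sq_diff e u y s * D y s ^ m / (A - u y s)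
        \<le> sq_diff e u y \<tau> * D y \<tau> ^ m / (A - u y \<tau>)"
  defines "W1 \<equiv> \<lambda>j. 2 * (\<Sum>i\<in>UNIV. diff_quot e i u y \<tau> * diff_quot e i (space_deriv j u) y \<tau>)"
  shows "W1 j / sq_diff e u y \<tau> + space_deriv j u y \<tau> / (A - u y \<tau>)
      + m * space_deriv j D y \<tau> / D y \<tau> = 0"
    and "0 \<le> (2 * (\<Sum>i\<in>UNIV. diff_quot e i u y \<tau> * diff_quot e i F y \<tau>)
          - 2 * (\<Sum>i\<in>UNIV. \<Sum>j\<in>UNIV. (diff_quot e i (space_deriv j u) y \<tau>)\<^sup>2)) / sq_diff e u y \<tau>
        + (\<Sum>j\<in>UNIV. (W1 j / sq_diff e u y \<tau>)\<^sup>2)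
        + F y \<tau> / (A - u y \<tau>) - (\<Sum>j\<in>UNIV. (space_deriv j u y \<tau> / (A - u y \<tau>))\<^sup>2)
        + m * ((time_deriv D y \<tau> - space_laplacian D y \<tau>) / D y \<tau>
          + (\<Sum>j\<in>UNIV. (space_deriv j D y \<tau> / D y \<tau>)\<^sup>2))"
proof -
  let ?q = "\<lambda>i v. diff_quot e i v y \<tau>"
  let ?W = "sq_diff e u y \<tau>" and ?b = "A - u y \<tau>" and ?D = "D y \<tau>"
  have us: "has_space_deriv_on Q i u" and us2: "has_space_deriv_on Q j (space_deriv i u)"
    and ut: "has_time_deriv_on Q u" for i j
    using u unfolding C21_on_def by auto
  have Ds: "has_space_deriv_on Q i D" and Ds2: "has_space_deriv_on Q j (space_deriv i D)"
    and Dt: "has_time_deriv_on Q D" for i j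
    using D unfolding C21_on_def by auto
  let ?l = "\<lambda>j s. y + s *\<^sub>R axis j 1"
  define W2 where "W2 j = 2 * (\<Sum>i\<in>UNIV. (?q i (space_deriv j u))\<^sup>2
      + ?q i u * ?q i (space_deriv j (space_deriv j u)))" for j
  define Wt where "Wt = 2 * (\<Sum>i\<in>UNIV. ?q i u * ?q i (time_deriv u))"
  have near: "\<forall>\<^sub>F s in nhds 0. (?l j s, \<tau>) \<in> Q \<and>
      (\<forall>i\<in>UNIV. (y + e *\<^sub>R axis i 1 + s *\<^sub>R axis j 1, \<tau>) \<in> Q)" for j
    by (intro eventually_conj eventually_ball_finite ballI eventually_line_in_open Q P) simp
  have WL: "\<forall>\<^sub>F s in nhds 0. ((\<lambda>s. sq_diff e u (?l j s) \<tau>) has_real_derivative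
      2 * (\<Sum>i\<in>UNIV. diff_quot e i u (?l j s) \<tau> * diff_quot e i (space_deriv j u) (?l j s) \<tau>)) (at s)" for j
    using near[of j]
  proof eventually_elim
    case (elim s)
    then show ?case unfolding sq_diff_def sum_distrib_left
      by (intro DERIV_sum) (auto intro!: derivative_eq_intros DERIV_diff_quot_space[OF us] simp: mult.assoc)
  qed
  have WL2: "((\<lambda>s. 2 * (\<Sum>i\<in>UNIV. diff_quot e i u (?l j s) \<tau> * diff_quot e i (space_deriv j u) (?l j s) \<tau>))
      has_real_derivative W2 j) (at 0)" for j
  proof -
    have 1: "((\<lambda>s. diff_quot e i u (?l j s) \<tau>) has_real_derivative ?q i (space_deriv j u)) (at 0)" for i
      using DERIV_diff_quot_space[OF us, of y 0 j \<tau> e i] P by simp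
    have 2: "((\<lambda>s. diff_quot e i (space_deriv j u) (?l j s) \<tau>) has_real_derivative
        ?q i (space_deriv j (space_deriv j u))) (at 0)" for i
      using DERIV_diff_quot_space[OF us2, of y 0 j \<tau> e i] P by simp
    show ?thesis unfolding W2_def
      by (intro DERIV_cmult DERIV_sum) (auto intro!: derivative_eq_intros 1 2 simp: power2_eq_square)
  qed
  have bL: "\<forall>\<^sub>F s in nhds 0. ((\<lambda>s. A - u (?l j s) \<tau>) has_real_derivative
      - space_deriv j u (?l j s) \<tau>) (at s)" for j
    using near[of j]
    by eventually_elim (auto intro!: derivative_eq_intros DERIV_space_line[OF us])
  have bL2: "((\<lambda>s. - space_deriv j u (?l j s) \<tau>) has_real_derivative
      - space_deriv j (space_deriv j u) y \<tau>) (at 0)" for j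
    using DERIV_minus[OF DERIV_space_line[OF us2, of y 0 j \<tau>]] P by simp
  have DL: "\<forall>\<^sub>F s in nhds 0. ((\<lambda>s. D (?l j s) \<tau>) has_real_derivative
      space_deriv j D (?l j s) \<tau>) (at s)" for j
    using near[of j] by eventually_elim (auto intro!: DERIV_space_line[OF Ds])
  have DL2: "((\<lambda>s. space_deriv j D (?l j s) \<tau>) has_real_derivative
      space_deriv j (space_deriv j D) y \<tau>) (at 0)" for j
    using DERIV_space_line[OF Ds2, of y 0 j \<tau>] P by simp
  have first: "W1 j / ?W + space_deriv j u y \<tau> / ?b + m * space_deriv j D y \<tau> / ?D = 0" for j
    using local_max_quotient_space(1)[OF WL[of j] WL2[of j] _ bL[of j] bL2[of j] _ DL[of j] DL2[of j], where m = m]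
      mx(1)[of j] pos by (simp add: W1_def)
  show "W1 j / ?W + space_deriv j u y \<tau> / ?b + m * space_deriv j D y \<tau> / ?D = 0" by (rule first)
  have second: "W2 j / ?W - (W1 j / ?W)\<^sup>2 + space_deriv j (space_deriv j u) y \<tau> / ?b
      + (space_deriv j u y \<tau> / ?b)\<^sup>2
      + m * (space_deriv j (space_deriv j D) y \<tau> / ?D - (space_deriv j D y \<tau> / ?D)\<^sup>2) \<le> 0" for j
    using local_max_quotient_space(2)[OF WL[of j] WL2[of j] _ bL[of j] bL2[of j] _ DL[of j] DL2[of j], where m = m]
      mx(1)[of j] pos by (simp add: W1_def power_divide)
  have time: "Wt / ?W + time_deriv u y \<tau> / ?b + m * time_deriv D y \<tau> / ?D \<ge> 0"
  proof -
    have "((\<lambda>t. sq_diff e u y t) has_real_derivative Wt) (at \<tau>)"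
      unfolding sq_diff_def Wt_def sum_distrib_left
      by (intro DERIV_sum) (auto intro!: derivative_eq_intros DERIV_diff_quot_time[OF ut] P simp: mult.assoc)
    moreover have "((\<lambda>t. A - u y t) has_real_derivative - time_deriv u y \<tau>) (at \<tau>)"
      by (auto intro!: derivative_eq_intros DERIV_time_line[OF ut] P)
    ultimately show ?thesis
      using left_max_quotient_time[OF _ _ _ _ DERIV_time_line[OF Dt P(1)], where m = m] mx(2) pos by fastforce
  qed
  have "(\<Sum>j\<in>UNIV. W2 j / ?W - (W1 j / ?W)\<^sup>2 + space_deriv j (space_deriv j u) y \<tau> / ?b
      + (space_deriv j u y \<tau> / ?b)\<^sup>2
      + m * (space_deriv j (space_deriv j D) y \<tau> / ?D - (space_deriv j D y \<tau> / ?D)\<^sup>2)) \<le> 0"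
    by (intro sum_nonpos second)
  then have sum: "(\<Sum>j\<in>UNIV. W2 j) / ?W - (\<Sum>j\<in>UNIV. (W1 j / ?W)\<^sup>2) + space_laplacian u y \<tau> / ?b
      + (\<Sum>j\<in>UNIV. (space_deriv j u y \<tau> / ?b)\<^sup>2)
      + m * (space_laplacian D y \<tau> / ?D - (\<Sum>j\<in>UNIV. (space_deriv j D y \<tau> / ?D)\<^sup>2)) \<le> 0"
    by (simp only: sum.distrib sum_subtractf sum_divide_distrib[symmetric]
        sum_distrib_left[symmetric] space_laplacian_def)
  \<comment> \<open>Subtracting the equation at the two end points of the quotient replaces
    differentiation of the equation.\<close>
  have "?q i F = ?q i (time_deriv u) - (\<Sum>j\<in>UNIV. ?q i (space_deriv j (space_deriv j u)))" for i
    unfolding diff_quot_def eq[OF P(1), symmetric] eq[OF P(2), symmetric] space_laplacian_def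
    by (simp add: diff_divide_distrib sum_subtractf flip: sum_divide_distrib)
  then have "2 * (\<Sum>i\<in>UNIV. ?q i u * ?q i F) = Wt - 2 * (\<Sum>i\<in>UNIV. \<Sum>j\<in>UNIV.
      ?q i u * ?q i (space_deriv j (space_deriv j u)))"
    by (simp add: Wt_def right_diff_distrib sum_subtractf sum_distrib_left)
  also have "(\<Sum>i\<in>UNIV. \<Sum>j\<in>UNIV. ?q i u * ?q i (space_deriv j (space_deriv j u)))
      = (\<Sum>j\<in>UNIV. \<Sum>i\<in>UNIV. ?q i u * ?q i (space_deriv j (space_deriv j u)))"
    by (rule sum.swap)
  finally have W2: "2 * (\<Sum>i\<in>UNIV. ?q i u * ?q i F) - 2 * (\<Sum>i\<in>UNIV. \<Sum>j\<in>UNIV. (?q i (space_deriv j u))\<^sup>2)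
      = Wt - (\<Sum>j\<in>UNIV. W2 j)"
    using sum.swap[of "\<lambda>i j. (?q i (space_deriv j u))\<^sup>2" UNIV UNIV]
    by (simp add: W2_def sum.distrib flip: sum_distrib_left)
  show "0 \<le> (2 * (\<Sum>i\<in>UNIV. ?q i u * ?q i F)
          - 2 * (\<Sum>i\<in>UNIV. \<Sum>j\<in>UNIV. (?q i (space_deriv j u))\<^sup>2)) / ?W
        + (\<Sum>j\<in>UNIV. (W1 j / ?W)\<^sup>2)
        + F y \<tau> / ?b - (\<Sum>j\<in>UNIV. (space_deriv j u y \<tau> / ?b)\<^sup>2)
        + m * ((time_deriv D y \<tau> - space_laplacian D y \<tau>) / ?D
          + (\<Sum>j\<in>UNIV. (space_deriv j D y \<tau> / ?D)\<^sup>2))"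
    unfolding W2 eq[OF P(1), symmetric] using sum time
    by (simp add: diff_divide_distrib algebra_simps)
qed


section \<open>Passage to the limit in the step size\<close>

lemma C21_onD:
  assumes "C21_on Q v"
  shows "continuous_on Q (\<lambda>(x, t). v x t)"
    and "continuous_on Q (\<lambda>(x, t). time_deriv v x t)"
    and "continuous_on Q (\<lambda>(x, t). space_deriv i v x t)"
    and "continuous_on Q (\<lambda>(x, t). space_deriv j (space_deriv i v) x t)"
    and "has_space_deriv_on Q i v" and "has_space_deriv_on Q j (space_deriv i v)"
    and "has_time_deriv_on Q v"
  using assms unfolding C21_on_def by auto

lemma norm_space_grad: "(norm (space_grad v x t))\<^sup>2 = (\<Sum>i\<in>UNIV. (space_deriv i v x t)\<^sup>2)"
  by (simp add: norm_vec_def L2_set_def space_grad_def sum_nonneg)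

lemma continuous_on_space_grad:
  assumes "C21_on Q v"
  shows "continuous_on Q (\<lambda>(x, t). space_grad v x t)"
  using C21_onD(3)[OF assms] unfolding space_grad_def case_prod_unfold
  by (intro continuous_on_vec_lambda) auto

lemma continuous_on_diff_quot:
  fixes v :: "real ^ 'n \<Rightarrow> real \<Rightarrow> real"
  assumes "continuous_on Q (\<lambda>(x, t). v x t)" "K \<subseteq> Q"
    "\<And>x t. (x, t) \<in> K \<Longrightarrow> (x + e *\<^sub>R axis i 1, t) \<in> Q" "e \<noteq> 0"
  shows "continuous_on K (\<lambda>(x, t). diff_quot e i v x t)"
proof -
  have "continuous_on K (\<lambda>z. (\<lambda>(x, t). v x t) (fst z + e *\<^sub>R axis i 1, snd z))"
    by (rule continuous_on_compose2[OF assms(1)]) (auto intro!: continuous_intros assms)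
  moreover have "continuous_on K (\<lambda>z. (\<lambda>(x, t). v x t) z)"
    by (rule continuous_on_subset[OF assms(1,2)])
  ultimately show ?thesis
    using assms(4) unfolding diff_quot_def case_prod_unfold by (intro continuous_intros) auto
qed

text \<open>Differentiating the equation would need third derivatives of \<open>u\<close>. Difference quotients
  avoid this: the maximum of the perturbed auxiliary function is attained at a point where only
  derivatives of \<open>u\<close> up to order two occur, and these pass to the limit.\<close>

lemma bernstein_limit:
  fixes u D F :: "real ^ 'n \<Rightarrow> real \<Rightarrow> real" and A s0 :: real and m :: nat
  assumes Q: "open Q" and u: "C21_on Q u" and D: "C21_on Q D"
    and eq: "\<And>x t. (x, t) \<in> Q \<Longrightarrow> time_deriv u x t - space_laplacian u x t = F x t"
    and F: "\<And>i x t. (x, t) \<in> Q \<Longrightarrow> space_grad u x t \<noteq> 0 \<Longrightarrow>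
        ((\<lambda>s. F (x + s *\<^sub>R axis i 1) t) has_real_derivative G i x t) (at 0)"
      "\<And>i. continuous_on (Q \<inter> (\<lambda>(x, t). space_grad u x t) -` (- {0})) (\<lambda>(x, t). G i x t)"
    and K: "compact K" "K \<subseteq> Q"
    and intr: "\<And>x t. (x, t) \<in> K \<Longrightarrow> D x t > 0 \<Longrightarrow> \<exists>d>0. ball x d \<times> {t - d<..t} \<subseteq> K"
    and D0: "\<And>x t. (x, t) \<in> K \<Longrightarrow> D x t \<ge> 0" and uA: "\<And>x t. (x, t) \<in> K \<Longrightarrow> u x t < A"
    and start: "(x0, s0) \<in> K" "D x0 s0 > 0" "space_grad u x0 s0 \<noteq> 0" and m: "m > 0"
  obtains y \<tau> where "(y, \<tau>) \<in> K" "D y \<tau> > 0" "space_grad u y \<tau> \<noteq> 0"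
    "(norm (space_grad u x0 s0))\<^sup>2 * D x0 s0 ^ m / (A - u x0 s0)
      \<le> (norm (space_grad u y \<tau>))\<^sup>2 * D y \<tau> ^ m / (A - u y \<tau>)"
    "\<forall>j. 2 * (\<Sum>i\<in>UNIV. space_deriv i u y \<tau> * space_deriv i (space_deriv j u) y \<tau>)
        / (norm (space_grad u y \<tau>))\<^sup>2 + space_deriv j u y \<tau> / (A - u y \<tau>)
      + m * space_deriv j D y \<tau> / D y \<tau> = 0"
    "0 \<le> (2 * (\<Sum>i\<in>UNIV. space_deriv i u y \<tau> * G i y \<tau>)
          - 2 * (\<Sum>i\<in>UNIV. \<Sum>j\<in>UNIV. (space_deriv i (space_deriv j u) y \<tau>)\<^sup>2))
            / (norm (space_grad u y \<tau>))\<^sup>2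
        + (\<Sum>j\<in>UNIV. (2 * (\<Sum>i\<in>UNIV. space_deriv i u y \<tau> * space_deriv i (space_deriv j u) y \<tau>)
            / (norm (space_grad u y \<tau>))\<^sup>2)\<^sup>2)
        + F y \<tau> / (A - u y \<tau>) - (\<Sum>j\<in>UNIV. (space_deriv j u y \<tau> / (A - u y \<tau>))\<^sup>2)
        + m * ((time_deriv D y \<tau> - space_laplacian D y \<tau>) / D y \<tau>
          + (\<Sum>j\<in>UNIV. (space_deriv j D y \<tau> / D y \<tau>)\<^sup>2))"
proof -
  have "\<exists>\<delta>>0. \<forall>P\<in>K. ball P \<delta> \<subseteq> Q"
    using compact_subset_open_imp_ball_epsilon_subset[OF K(1) Q K(2)] by (metis UN_subset_iff)
  then obtain \<delta> where \<delta>: "\<delta> > 0" "\<And>P. P \<in> K \<Longrightarrow> ball P \<delta> \<subseteq> Q" by blast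
  \<comment> \<open>Steps below \<open>\<delta>\<close> keep the shifted points in \<open>Q\<close>,
    uniformly over \<open>K\<close>.\<close>
  define E where "E n = \<delta> / 2 * inverse (real (Suc n))" for n
  have E: "E n > 0" "E n < \<delta>" for n
  proof -
    show "E n > 0" using \<delta> by (simp add: E_def)
    have "inverse (real (Suc n)) \<le> 1" by (simp add: inverse_le_1_iff)
    then have "E n \<le> \<delta> / 2 * 1" unfolding E_def using \<delta> by (intro mult_left_mono) auto
    with \<delta> show "E n < \<delta>" by simp
  qed
  have Elim: "E \<longlonglongrightarrow> 0"
    unfolding E_def by (intro tendsto_mult_right_zero LIMSEQ_inverse_real_of_nat)
  have shift: "(x + E n *\<^sub>R axis i 1, t) \<in> Q" if "(x, t) \<in> K" for n i x t
  proof -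
    have "dist (x, t) (x + E n *\<^sub>R axis i 1, t) = E n"
      using E(1)[of n] by (simp add: dist_Pair_Pair dist_norm)
    then show ?thesis using \<delta>(2)[OF that] E(2)[of n] by auto
  qed
  define V where "V n = (\<lambda>(x, t). sq_diff (E n) u x t * D x t ^ m / (A - u x t))" for n
  have "continuous_on K (V n)" for n
  proof -
    have 1: "continuous_on K (\<lambda>(x, t). diff_quot (E n) i u x t)" for i
      using continuous_on_diff_quot[OF C21_onD(1)[OF u] K(2) shift] E(1)[of n] by auto
    have 2: "continuous_on K (\<lambda>(x, t). u x t)" "continuous_on K (\<lambda>(x, t). D x t)"
      using C21_onD(1)[OF u] C21_onD(1)[OF D] K(2) continuous_on_subset by blast+
    have 3: "\<forall>z\<in>K. A - u (fst z) (snd z) \<noteq> 0" using uA by (metis less_irrefl eq_iff_diff_eq_0 prod.collapse)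
    show ?thesis
      using 1 2 3 unfolding V_def sq_diff_def case_prod_unfold by (intro continuous_intros) auto
  qed
  then have "\<forall>n. \<exists>z\<in>K. \<forall>z'\<in>K. V n z' \<le> V n z"
    using continuous_attains_sup[OF K(1)] start(1) by (metis empty_iff)
  then obtain P where P: "\<And>n. P n \<in> K" "\<And>n z. z \<in> K \<Longrightarrow> V n z \<le> V n (P n)" by metis
  obtain l r where l: "l \<in> K" "strict_mono r" "(P \<circ> r) \<longlonglongrightarrow> l"
    using K(1) P(1) unfolding compact_def by metis
  obtain y \<tau> where ly: "l = (y, \<tau>)" by (cases l)
  define X T e where "X n = fst (P (r n))" and "T n = snd (P (r n))" and "e n = E (r n)" for n
  have XT: "(X n, T n) = P (r n)" for n by (simp add: X_def T_def)
  have XTK: "(X n, T n) \<in> K" for n using P(1) XT by simp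
  have XTlim: "(\<lambda>n. (X n, T n)) \<longlonglongrightarrow> (y, \<tau>)" using l(3) XT ly by (simp add: o_def)
  have X: "X \<longlonglongrightarrow> y" and T: "T \<longlonglongrightarrow> \<tau>"
    using tendsto_fst[OF XTlim] tendsto_snd[OF XTlim] by simp_all
  have e: "e \<longlonglongrightarrow> 0" "\<And>n. e n > 0"
    using LIMSEQ_subseq_LIMSEQ[OF Elim l(2)] E by (auto simp: e_def[abs_def] o_def)
  have yK: "(y, \<tau>) \<in> K" and yQ: "(y, \<tau>) \<in> Q" using l ly K by auto
  have lim: "(\<lambda>n. g (X n) (T n)) \<longlonglongrightarrow> g y \<tau>" if "continuous_on Q (\<lambda>(x, t). g x t)"
    for g :: "real ^ 'n \<Rightarrow> real \<Rightarrow> real"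
    using continuous_on_tendsto_compose[OF that XTlim yQ] subsetD[OF K(2) XTK] by simp
  have qlim: "(\<lambda>n. diff_quot (e n) i v (X' n) (T' n)) \<longlonglongrightarrow> space_deriv i v x t"
    if "has_space_deriv_on Q i v" "continuous_on Q (\<lambda>(x, t). space_deriv i v x t)"
      "X' \<longlonglongrightarrow> x" "T' \<longlonglongrightarrow> t" "(x, t) \<in> Q"
    for v :: "real ^ 'n \<Rightarrow> real \<Rightarrow> real" and i X' T' x t
    using DERIV_space_line[OF that(1), of _ 0]
    by (intro tendsto_diff_quot[OF Q that(5) _ that(2,3,4) e]) simp
  note uq = qlim[OF C21_onD(5)[OF u] C21_onD(3)[OF u]]
  have Wlim: "(\<lambda>n. sq_diff (e n) u (X' n) (T' n)) \<longlonglongrightarrow> (norm (space_grad u x t))\<^sup>2"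
    if "X' \<longlonglongrightarrow> x" "T' \<longlonglongrightarrow> t" "(x, t) \<in> Q" for X' T' x t
    unfolding sq_diff_def norm_space_grad by (intro tendsto_intros uq that)
  have Wl: "(\<lambda>n. sq_diff (e n) u (X n) (T n)) \<longlonglongrightarrow> (norm (space_grad u y \<tau>))\<^sup>2"
    by (rule Wlim[OF X T yQ])
  note Dl = lim[OF C21_onD(1)[OF D]]
  have Vy: "(\<lambda>n. V (r n) (P (r n))) \<longlonglongrightarrow> (norm (space_grad u y \<tau>))\<^sup>2 * D y \<tau> ^ m / (A - u y \<tau>)"
    unfolding XT[symmetric] V_def prod.case e_def[symmetric] using uA[OF yK]
    by (intro tendsto_intros Wl Dl lim C21_onD(1)[OF u]) auto
  have Vx: "(\<lambda>n. V (r n) (x0, s0)) \<longlonglongrightarrow> (norm (space_grad u x0 s0))\<^sup>2 * D x0 s0 ^ m / (A - u x0 s0)"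
    unfolding V_def prod.case e_def[symmetric] using uA[OF start(1)] start(1) K
    by (intro tendsto_intros Wlim) auto
  have le: "(norm (space_grad u x0 s0))\<^sup>2 * D x0 s0 ^ m / (A - u x0 s0)
      \<le> (norm (space_grad u y \<tau>))\<^sup>2 * D y \<tau> ^ m / (A - u y \<tau>)"
    by (rule LIMSEQ_le[OF Vx Vy]) (use P(2) start(1) in auto)
  \<comment> \<open>The limit of the maximal values is at least the positive value at the starting
    point, so at the limit point neither the gradient nor \<open>D\<close> can vanish. This licenses
    the divisions that follow and the use of \<open>G\<close>.\<close>
  have "0 < (norm (space_grad u x0 s0))\<^sup>2 * D x0 s0 ^ m / (A - u x0 s0)"
    using start uA[OF start(1)] by (intro divide_pos_pos mult_pos_pos) auto
  with le have "(norm (space_grad u y \<tau>))\<^sup>2 * D y \<tau> ^ m / (A - u y \<tau>) \<noteq> 0" by linarith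
  then have gy: "space_grad u y \<tau> \<noteq> 0" and "D y \<tau> ^ m \<noteq> 0"
    by auto
  then have Dy: "D y \<tau> > 0"
    using D0[OF yK] m by (cases "D y \<tau> = 0") simp_all
  have byn: "A - u y \<tau> \<noteq> 0" using uA[OF yK] by simp
  have gy2: "(norm (space_grad u y \<tau>))\<^sup>2 \<noteq> 0" and gy2': "(norm (space_grad u y \<tau>))\<^sup>2 > 0"
    using gy by auto
  let ?q = "\<lambda>n i v. diff_quot (e n) i v (X n) (T n)" and ?W = "\<lambda>n. sq_diff (e n) u (X n) (T n)"
  \<comment> \<open>\<open>G\<close> is given as the derivative of \<open>F\<close> only where the
    gradient is nonzero; by continuity of the gradient this is an open set, and it contains the
    limit point.\<close>
  have Fq: "(\<lambda>n. ?q n i F) \<longlonglongrightarrow> G i y \<tau>" for i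
  proof (rule tendsto_diff_quot[OF _ _ _ F(2) X T e])
    show "open (Q \<inter> (\<lambda>(x, t). space_grad u x t) -` (- {0}))"
      by (intro continuous_open_preimage continuous_on_space_grad u Q) auto
    show "(y, \<tau>) \<in> Q \<inter> (\<lambda>(x, t). space_grad u x t) -` (- {0})" using yQ gy by simp
  qed (use F(1) in auto)
  note uql = uq[OF X T yQ] and uqql = qlim[OF C21_onD(6)[OF u] C21_onD(4)[OF u] X T yQ]
  have "\<forall>\<^sub>F n in sequentially. ?W n > 0 \<and> D (X n) (T n) > 0"
    using order_tendstoD(1)[OF Wl gy2'] order_tendstoD(1)[OF Dl Dy] by eventually_elim auto
  then have ev: "\<forall>\<^sub>F n in sequentially.
    (\<forall>j. 2 * (\<Sum>i\<in>UNIV. ?q n i u * ?q n i (space_deriv j u)) / ?W n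
      + space_deriv j u (X n) (T n) / (A - u (X n) (T n))
      + m * space_deriv j D (X n) (T n) / D (X n) (T n) = 0) \<and>
    0 \<le> (2 * (\<Sum>i\<in>UNIV. ?q n i u * ?q n i F)
          - 2 * (\<Sum>i\<in>UNIV. \<Sum>j\<in>UNIV. (?q n i (space_deriv j u))\<^sup>2)) / ?W n
        + (\<Sum>j\<in>UNIV. (2 * (\<Sum>i\<in>UNIV. ?q n i u * ?q n i (space_deriv j u)) / ?W n)\<^sup>2)
        + F (X n) (T n) / (A - u (X n) (T n))
        - (\<Sum>j\<in>UNIV. (space_deriv j u (X n) (T n) / (A - u (X n) (T n)))\<^sup>2)
        + m * ((time_deriv D (X n) (T n) - space_laplacian D (X n) (T n)) / D (X n) (T n)
          + (\<Sum>j\<in>UNIV. (space_deriv j D (X n) (T n) / D (X n) (T n))\<^sup>2))"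
  proof eventually_elim
    case (elim n)
    \<comment> \<open>Positivity of \<open>D\<close> puts the maximum point in the interior of
      \<open>K\<close> in space and leaves room in \<open>K\<close> for earlier times.\<close>
    then obtain d where d: "d > 0" "ball (X n) d \<times> {T n - d<..T n} \<subseteq> K"
      using intr[OF XTK] by blast
    have mx: "V (r n) (x, t) \<le> V (r n) (X n, T n)" if "(x, t) \<in> K" for x t
      using P(2)[OF that] XT by simp
    have "\<forall>\<^sub>F s in nhds 0. V (r n) (X n + s *\<^sub>R axis j 1, T n) \<le> V (r n) (X n, T n)" for j
      unfolding eventually_nhds_metric
    proof (intro exI conjI allI impI)
      fix s :: real assume "dist s 0 < d"
      then show "V (r n) (X n + s *\<^sub>R axis j 1, T n) \<le> V (r n) (X n, T n)"
        using d by (intro mx) (auto simp: dist_norm subset_iff)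
    qed (rule d)
    moreover have "\<forall>\<^sub>F s in at_left (T n). V (r n) (X n, s) \<le> V (r n) (X n, T n)"
      using d by (intro eventually_at_leftI[of "T n - d"] mx) auto
    ultimately have mx': "\<And>j. \<forall>\<^sub>F s in nhds 0.
        sq_diff (e n) u (X n + s *\<^sub>R axis j 1) (T n) * D (X n + s *\<^sub>R axis j 1) (T n) ^ m
          / (A - u (X n + s *\<^sub>R axis j 1) (T n))
        \<le> sq_diff (e n) u (X n) (T n) * D (X n) (T n) ^ m / (A - u (X n) (T n))"
      "\<forall>\<^sub>F s in at_left (T n). sq_diff (e n) u (X n) s * D (X n) s ^ m / (A - u (X n) s)
        \<le> sq_diff (e n) u (X n) (T n) * D (X n) (T n) ^ m / (A - u (X n) (T n))"
      unfolding V_def prod.case e_def by auto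
    have Pn: "(X n, T n) \<in> Q" "\<And>i. (X n + e n *\<^sub>R axis i 1, T n) \<in> Q"
      using XTK K shift unfolding e_def by auto
    note b = bernstein_at_max[OF Q u D eq Pn _ uA[OF XTK] _ mx']
    show ?case using b elim by simp
  qed
  note ulim = lim[OF C21_onD(1)[OF u]] lim[OF C21_onD(3)[OF u]]
    and Dlim = Dl lim[OF C21_onD(2)[OF D]] lim[OF C21_onD(3)[OF D]]
  have first: "2 * (\<Sum>i\<in>UNIV. space_deriv i u y \<tau> * space_deriv i (space_deriv j u) y \<tau>)
        / (norm (space_grad u y \<tau>))\<^sup>2 + space_deriv j u y \<tau> / (A - u y \<tau>)
      + m * space_deriv j D y \<tau> / D y \<tau> = 0" for j
  proof (rule LIMSEQ_unique[OF _ tendsto_eventually])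
    show "\<forall>\<^sub>F n in sequentially. 2 * (\<Sum>i\<in>UNIV. ?q n i u * ?q n i (space_deriv j u)) / ?W n
      + space_deriv j u (X n) (T n) / (A - u (X n) (T n))
      + m * space_deriv j D (X n) (T n) / D (X n) (T n) = 0"
      using ev by eventually_elim blast
  qed (use Dy in \<open>intro tendsto_intros uql uqql Wl ulim Dlim gy2 byn; simp\<close>)
  have second: "0 \<le> (2 * (\<Sum>i\<in>UNIV. space_deriv i u y \<tau> * G i y \<tau>)
          - 2 * (\<Sum>i\<in>UNIV. \<Sum>j\<in>UNIV. (space_deriv i (space_deriv j u) y \<tau>)\<^sup>2))
            / (norm (space_grad u y \<tau>))\<^sup>2
        + (\<Sum>j\<in>UNIV. (2 * (\<Sum>i\<in>UNIV. space_deriv i u y \<tau> * space_deriv i (space_deriv j u) y \<tau>)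
            / (norm (space_grad u y \<tau>))\<^sup>2)\<^sup>2)
        + F y \<tau> / (A - u y \<tau>) - (\<Sum>j\<in>UNIV. (space_deriv j u y \<tau> / (A - u y \<tau>))\<^sup>2)
        + m * ((time_deriv D y \<tau> - space_laplacian D y \<tau>) / D y \<tau>
          + (\<Sum>j\<in>UNIV. (space_deriv j D y \<tau> / D y \<tau>)\<^sup>2))"
  proof (rule tendsto_lowerbound[OF _ conjunct2[OF ev[unfolded eventually_conj_iff]]])
    have lap: "(\<lambda>n. space_laplacian v (X n) (T n)) \<longlonglongrightarrow> space_laplacian v y \<tau>"
      if "C21_on Q v" for v
      unfolding space_laplacian_def by (intro tendsto_intros lim C21_onD[OF that])
    \<comment> \<open>\<open>F\<close> converges along the sequence because the equation identifies
      it with u_t - Delta u, whose terms are continuous.\<close>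
    have "(\<lambda>n. time_deriv u (X n) (T n) - space_laplacian u (X n) (T n))
        \<longlonglongrightarrow> time_deriv u y \<tau> - space_laplacian u y \<tau>"
      by (intro tendsto_intros lim lap C21_onD[OF u] u)
    moreover have "time_deriv u (X n) (T n) - space_laplacian u (X n) (T n) = F (X n) (T n)" for n
      using eq XTK K by blast
    ultimately have Fl: "(\<lambda>n. F (X n) (T n)) \<longlonglongrightarrow> F y \<tau>" using eq[OF yQ] by simp
    show "(\<lambda>n. (2 * (\<Sum>i\<in>UNIV. ?q n i u * ?q n i F)
          - 2 * (\<Sum>i\<in>UNIV. \<Sum>j\<in>UNIV. (?q n i (space_deriv j u))\<^sup>2)) / ?W n
        + (\<Sum>j\<in>UNIV. (2 * (\<Sum>i\<in>UNIV. ?q n i u * ?q n i (space_deriv j u)) / ?W n)\<^sup>2)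
        + F (X n) (T n) / (A - u (X n) (T n))
        - (\<Sum>j\<in>UNIV. (space_deriv j u (X n) (T n) / (A - u (X n) (T n)))\<^sup>2)
        + m * ((time_deriv D (X n) (T n) - space_laplacian D (X n) (T n)) / D (X n) (T n)
          + (\<Sum>j\<in>UNIV. (space_deriv j D (X n) (T n) / D (X n) (T n))\<^sup>2))) \<longlonglongrightarrow>
        (2 * (\<Sum>i\<in>UNIV. space_deriv i u y \<tau> * G i y \<tau>)
          - 2 * (\<Sum>i\<in>UNIV. \<Sum>j\<in>UNIV. (space_deriv i (space_deriv j u) y \<tau>)\<^sup>2))
            / (norm (space_grad u y \<tau>))\<^sup>2
        + (\<Sum>j\<in>UNIV. (2 * (\<Sum>i\<in>UNIV. space_deriv i u y \<tau> * space_deriv i (space_deriv j u) y \<tau>)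
            / (norm (space_grad u y \<tau>))\<^sup>2)\<^sup>2)
        + F y \<tau> / (A - u y \<tau>) - (\<Sum>j\<in>UNIV. (space_deriv j u y \<tau> / (A - u y \<tau>))\<^sup>2)
        + m * ((time_deriv D y \<tau> - space_laplacian D y \<tau>) / D y \<tau>
          + (\<Sum>j\<in>UNIV. (space_deriv j D y \<tau> / D y \<tau>)\<^sup>2))"
      using Dy by (intro tendsto_intros uql uqql Fq Fl Wl ulim Dlim lap[OF D] gy2 byn; simp)
  qed (rule sequentially_bot)
  show ?thesis by (rule that[OF yK Dy gy le allI[OF first] second])
qed


section \<open>The parabolic cutoff\<close>

text \<open>A downward paraboloid in space times a linear ramp in time. It vanishes for |x - z| = r
  and for t = t0, equals 1 at the centre at time t0 + sigma, and is polynomial, so all its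
  derivatives are explicit. The high power needed for the estimate is taken separately.\<close>

definition barrier :: "real ^ 'n \<Rightarrow> real \<Rightarrow> real \<Rightarrow> real \<Rightarrow> real ^ 'n \<Rightarrow> real \<Rightarrow> real" where
  "barrier z r t0 \<sigma> x t = (1 - (norm (x - z))\<^sup>2 / r\<^sup>2) * ((t - t0) / \<sigma>)"

lemma norm_sq_line:
  fixes x :: "real ^ 'n"
  shows "(norm (x + s *\<^sub>R axis i 1))\<^sup>2 = (norm x)\<^sup>2 + 2 * s * x $ i + s\<^sup>2"
  unfolding power2_norm_eq_inner
  by (simp add: inner_add_left inner_add_right inner_axis inner_axis' power2_eq_square algebra_simps)

lemma barrier_derivs:
  fixes z :: "real ^ 'n"
  shows "((\<lambda>s. barrier z r t0 \<sigma> (x + s *\<^sub>R axis i 1) t) has_real_derivative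
      - 2 * (x - z) $ i / r\<^sup>2 * ((t - t0) / \<sigma>)) (at 0)" (is ?A)
    and "((\<lambda>s. - 2 * (x + s *\<^sub>R axis j 1 - z) $ i / r\<^sup>2 * ((t - t0) / \<sigma>)) has_real_derivative
      (if i = j then - 2 / r\<^sup>2 * ((t - t0) / \<sigma>) else 0)) (at 0)" (is ?B)
    and "(barrier z r t0 \<sigma> x has_real_derivative (1 - (norm (x - z))\<^sup>2 / r\<^sup>2) / \<sigma>) (at t)" (is ?C)
proof -
  have 1: "(norm (x + s *\<^sub>R axis i 1 - z))\<^sup>2 = (norm (x - z))\<^sup>2 + 2 * s * (x - z) $ i + s\<^sup>2" for s
    using norm_sq_line[of "x - z" s i] by (simp add: algebra_simps)
  have "((\<lambda>s. (1 - (a + 2 * s * b + s\<^sup>2) * k) * c) has_real_derivative - 2 * b * k * c) (at 0)"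
    for a b c k :: real by (auto intro!: derivative_eq_intros)
  from this[of "(norm (x - z))\<^sup>2" "(x - z) $ i" "inverse (r\<^sup>2)" "(t - t0) / \<sigma>"]
  show ?A unfolding barrier_def 1 by (simp add: divide_inverse)
  have "((\<lambda>s. - 2 * (a + s * e) * k * c) has_real_derivative - 2 * e * k * c) (at 0)"
    for a e c k :: real by (auto intro!: derivative_eq_intros)
  note lin = this[of "(x - z) $ i" "if i = j then 1 else 0" "inverse (r\<^sup>2)" "(t - t0) / \<sigma>"]
  have eq: "(x + s *\<^sub>R axis j 1 - z) $ i = (x - z) $ i + s * (if i = j then 1 else 0)" for s
    by (simp add: axis_def)
  have "- 2 * (if i = j then 1 else 0) * inverse (r\<^sup>2) * c = (if i = j then - 2 / r\<^sup>2 * c else 0)"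
    for c by (simp add: divide_inverse)
  from DERIV_cong[OF lin this] show ?B unfolding eq by (simp only: divide_inverse)
  have "((\<lambda>t. k * ((t - t0) * c)) has_real_derivative k * c) (at t)" for k c
    by (auto intro!: derivative_eq_intros)
  then show ?C unfolding barrier_def[abs_def] divide_inverse[of _ \<sigma>] by blast
qed

lemma space_deriv_barrier:
  "space_deriv i (barrier z r t0 \<sigma>) = (\<lambda>x t. - 2 * (x - z) $ i / r\<^sup>2 * ((t - t0) / \<sigma>))"
  unfolding space_deriv_def using DERIV_imp_deriv[OF barrier_derivs(1)] by (intro ext) blast

lemma space_deriv2_barrier:
  "space_deriv j (space_deriv i (barrier z r t0 \<sigma>))
    = (\<lambda>x t. if i = j then - 2 / r\<^sup>2 * ((t - t0) / \<sigma>) else 0)"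
  unfolding space_deriv_barrier unfolding space_deriv_def
  using DERIV_imp_deriv[OF barrier_derivs(2)] by (intro ext) blast

lemma time_deriv_barrier:
  "time_deriv (barrier z r t0 \<sigma>) = (\<lambda>x t. (1 - (norm (x - z))\<^sup>2 / r\<^sup>2) / \<sigma>)"
  unfolding time_deriv_def using DERIV_imp_deriv[OF barrier_derivs(3)] by (intro ext) blast

lemma C21_on_barrier:
  fixes z :: "real ^ 'n"
  assumes "r \<noteq> 0" "\<sigma> \<noteq> 0"
  shows "C21_on Q (barrier z r t0 \<sigma>)"
proof -
  have "has_time_deriv_on Q (barrier z r t0 \<sigma>)"
    unfolding has_time_deriv_on_def
    using barrier_derivs(3) unfolding field_differentiable_def by blast
  moreover have "has_space_deriv_on Q i (barrier z r t0 \<sigma>)" for i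
    unfolding has_space_deriv_on_def
    using barrier_derivs(1) unfolding field_differentiable_def by blast
  moreover have "has_space_deriv_on Q j (space_deriv i (barrier z r t0 \<sigma>))" for i j
    unfolding has_space_deriv_on_def space_deriv_barrier
    using barrier_derivs(2) unfolding field_differentiable_def by blast
  moreover have "continuous_on Q (\<lambda>(x, t). barrier z r t0 \<sigma> x t)"
    unfolding case_prod_unfold barrier_def using assms by (intro continuous_intros) auto
  moreover have "continuous_on Q (\<lambda>(x, t). time_deriv (barrier z r t0 \<sigma>) x t)"
    unfolding case_prod_unfold time_deriv_barrier using assms by (intro continuous_intros) auto
  moreover have "continuous_on Q (\<lambda>(x, t). space_deriv i (barrier z r t0 \<sigma>) x t)" for i
    unfolding case_prod_unfold space_deriv_barrier using assms by (intro continuous_intros) auto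
  moreover have "continuous_on Q (\<lambda>(x, t). space_deriv j (space_deriv i (barrier z r t0 \<sigma>)) x t)" for i j
    unfolding case_prod_unfold space_deriv2_barrier using assms
    by (cases "i = j") (auto intro!: continuous_intros)
  ultimately show ?thesis unfolding C21_on_def by blast
qed

lemma barrier_bounds:
  fixes z :: "real ^ 'n"
  assumes r: "r > 0" and \<sigma>: "\<sigma> > 0" and x: "norm (x - z) \<le> r" and t: "t0 \<le> t" "t \<le> t0 + \<sigma>"
  shows "0 \<le> barrier z r t0 \<sigma> x t" and "barrier z r t0 \<sigma> x t \<le> 1"
    and "(\<Sum>j\<in>UNIV. (space_deriv j (barrier z r t0 \<sigma>) x t)\<^sup>2) \<le> (2 / r)\<^sup>2"
    and "time_deriv (barrier z r t0 \<sigma>) x t - space_laplacian (barrier z r t0 \<sigma>) x t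
      \<le> 1 / \<sigma> + 2 * CARD('n) / r\<^sup>2"
proof -
  let ?a = "(norm (x - z))\<^sup>2 / r\<^sup>2" and ?b = "(t - t0) / \<sigma>"
  have "(norm (x - z))\<^sup>2 \<le> r\<^sup>2" using x by (intro power_mono) auto
  then have a: "0 \<le> ?a" "?a \<le> 1" using r by auto
  have b: "0 \<le> ?b" "?b \<le> 1" using t \<sigma> by auto
  show "0 \<le> barrier z r t0 \<sigma> x t" unfolding barrier_def using a b by (intro mult_nonneg_nonneg) auto
  show "barrier z r t0 \<sigma> x t \<le> 1" unfolding barrier_def using a b by (intro mult_le_one) auto
  have "(\<Sum>j\<in>UNIV. (space_deriv j (barrier z r t0 \<sigma>) x t)\<^sup>2)
      = (\<Sum>j\<in>UNIV. ((2 / r\<^sup>2) * ?b)\<^sup>2 * ((x - z) $ j)\<^sup>2)"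
  proof (intro sum.cong refl)
    have "(- 2 * a / k * b)\<^sup>2 = (2 / k * b)\<^sup>2 * a\<^sup>2" for a b k :: real
      by (simp add: power_mult_distrib power_divide)
    then show "(space_deriv j (barrier z r t0 \<sigma>) x t)\<^sup>2 = ((2 / r\<^sup>2) * ?b)\<^sup>2 * ((x - z) $ j)\<^sup>2" for j
      unfolding space_deriv_barrier by blast
  qed
  also have "\<dots> = ((2 / r\<^sup>2) * ?b)\<^sup>2 * (norm (x - z))\<^sup>2"
    by (simp add: norm_vec_def L2_set_def sum_nonneg sum_distrib_left)
  also have "\<dots> = (2 / r)\<^sup>2 * (?b\<^sup>2 * ?a)"
    using r by (simp add: field_simps power2_eq_square)
  also have "\<dots> \<le> (2 / r)\<^sup>2 * 1"
    using a b by (intro mult_left_mono mult_le_one power_le_one) auto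
  finally show "(\<Sum>j\<in>UNIV. (space_deriv j (barrier z r t0 \<sigma>) x t)\<^sup>2) \<le> (2 / r)\<^sup>2" by simp
  have "space_laplacian (barrier z r t0 \<sigma>) x t = - (2 * CARD('n) / r\<^sup>2 * ?b)"
    unfolding space_laplacian_def space_deriv2_barrier by simp
  moreover have "2 * CARD('n) / r\<^sup>2 * ?b \<le> 2 * CARD('n) / r\<^sup>2 * 1"
    using b by (intro mult_left_mono) auto
  moreover have "time_deriv (barrier z r t0 \<sigma>) x t \<le> 1 / \<sigma>"
    unfolding time_deriv_barrier using a \<sigma> by (intro divide_right_mono) auto
  ultimately show "time_deriv (barrier z r t0 \<sigma>) x t - space_laplacian (barrier z r t0 \<sigma>) x t
      \<le> 1 / \<sigma> + 2 * CARD('n) / r\<^sup>2" by simp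
qed

section \<open>Differentiating the right-hand side of the equation\<close>

text \<open>Only a zero of \<open>f\<close> needs care. There the quotient of
  \<open>f powr p\<close> is that of \<open>f\<close> times \<open>f powr (p - 1)\<close>, and the
  last factor tends to 0 because p > 1. This agrees with the formula, since
  \<open>0 powr (p - 1) = 0\<close>.\<close>

lemma DERIV_powr_nonneg:
  fixes f :: "real \<Rightarrow> real"
  assumes f: "(f has_real_derivative f') (at a)" and nn: "\<forall>\<^sub>F s in nhds a. f s \<ge> 0" and p: "p > 1"
  shows "((\<lambda>s. f s powr p) has_real_derivative p * f a powr (p - 1) * f') (at a)"
proof (cases "f a = 0")
  case False
  then have "f a > 0" using eventually_nhds_x_imp_x[OF nn] by simp
  then show ?thesis using f by (auto intro!: derivative_eq_intros simp: field_simps powr_diff)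
next
  case True
  have nn': "\<forall>\<^sub>F s in at a. f s \<ge> 0" using nn by (simp add: eventually_nhds_conv_at)
  have "(f \<longlongrightarrow> 0) (at a)" using DERIV_isCont[OF f] True by (simp add: isCont_def)
  then have "((\<lambda>s. f s powr (p - 1)) \<longlongrightarrow> 0 powr (p - 1)) (at a)"
    using nn' p by (intro tendsto_powr') auto
  from tendsto_mult[OF f[unfolded has_field_derivative_iff] this]
  have "((\<lambda>s. (f s - f a) / (s - a) * f s powr (p - 1)) \<longlongrightarrow> 0) (at a)" using p by simp
  moreover have "\<forall>\<^sub>F s in at a. (f s - f a) / (s - a) * f s powr (p - 1)
      = (f s powr p - f a powr p) / (s - a)"
    using nn'
  proof eventually_elim
    case (elim s)
    then have "f s powr p = f s * f s powr (p - 1)"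
      using powr_add[of "f s" 1 "p - 1"] by simp
    then show ?case using True p by simp
  qed
  ultimately have "((\<lambda>s. (f s powr p - f a powr p) / (s - a)) \<longlongrightarrow> 0) (at a)"
    by (rule Lim_transform_eventually)
  then show ?thesis using True p by (simp add: has_field_derivative_iff)
qed

text \<open>|grad u|^q is differentiated as the power q / 2 of the sum of squares, which is positive
  where the gradient does not vanish.\<close>

lemma DERIV_reaction:
  fixes u :: "real ^ 'n \<Rightarrow> real \<Rightarrow> real"
  assumes Q: "open Q" and u: "C21_on Q u" and nn: "\<And>x t. (x, t) \<in> Q \<Longrightarrow> 0 \<le> u x t" and p: "p > 1"
    and x: "(x, t) \<in> Q" "space_grad u x t \<noteq> 0"
  shows "((\<lambda>s. u (x + s *\<^sub>R axis i 1) t powr p + M * norm (space_grad u (x + s *\<^sub>R axis i 1) t) powr q)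
    has_real_derivative p * u x t powr (p - 1) * space_deriv i u x t
      + M * (q * norm (space_grad u x t) powr (q - 2)
          * (\<Sum>j\<in>UNIV. space_deriv j u x t * space_deriv i (space_deriv j u) x t))) (at 0)"
proof -
  have eq: "norm (space_grad u x t) powr q = (\<Sum>j\<in>UNIV. (space_deriv j u x t)\<^sup>2) powr (q / 2)" for x t
    by (cases "space_grad u x t = 0") (simp_all add: powr_powr flip: norm_space_grad powr_numeral)
  have pos: "(\<Sum>j\<in>UNIV. (space_deriv j u x t)\<^sup>2) > 0"
    using x(2) by (simp flip: norm_space_grad)
  have p1: "(\<Sum>j\<in>UNIV. (space_deriv j u x t)\<^sup>2) powr (q / 2 - 1) = norm (space_grad u x t) powr (q - 2)"
    using x(2) by (simp add: powr_powr flip: norm_space_grad powr_numeral)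
  have "((\<lambda>s. \<Sum>j\<in>UNIV. (space_deriv j u (x + s *\<^sub>R axis i 1) t)\<^sup>2) has_real_derivative
      2 * (\<Sum>j\<in>UNIV. space_deriv j u x t * space_deriv i (space_deriv j u) x t)) (at 0)"
    unfolding sum_distrib_left
    using DERIV_space_line[OF C21_onD(6)[OF u], of x 0 i t] x(1)
    by (intro DERIV_sum) (auto intro!: derivative_eq_intros)
  from DERIV_fun_powr[OF this, of "q / 2"] pos
  have "((\<lambda>s. norm (space_grad u (x + s *\<^sub>R axis i 1) t) powr q) has_real_derivative
      q * norm (space_grad u x t) powr (q - 2)
          * (\<Sum>j\<in>UNIV. space_deriv j u x t * space_deriv i (space_deriv j u) x t)) (at 0)"
    unfolding eq by (simp add: p1 mult.assoc)
  moreover have "((\<lambda>s. u (x + s *\<^sub>R axis i 1) t powr p) has_real_derivative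
      p * u x t powr (p - 1) * space_deriv i u x t) (at 0)"
  proof -
    have "\<forall>\<^sub>F s in nhds 0. u (x + s *\<^sub>R axis i 1) t \<ge> 0"
      using eventually_line_in_open[OF Q x(1), of i] by eventually_elim (rule nn)
    from DERIV_powr_nonneg[OF _ this p] DERIV_space_line[OF C21_onD(5)[OF u], of x 0 i t] x(1)
    show ?thesis by simp
  qed
  ultimately show ?thesis by (intro DERIV_add DERIV_cmult)
qed

lemma continuous_on_reaction_deriv:
  fixes u :: "real ^ 'n \<Rightarrow> real \<Rightarrow> real"
  assumes u: "C21_on Q u" and nn: "\<And>x t. (x, t) \<in> Q \<Longrightarrow> 0 \<le> u x t" and p: "p > 1"
  shows "continuous_on (Q \<inter> (\<lambda>(x, t). space_grad u x t) -` (- {0})) (\<lambda>(x, t).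
    p * u x t powr (p - 1) * space_deriv i u x t
      + M * (q * norm (space_grad u x t) powr (q - 2)
          * (\<Sum>j\<in>UNIV. space_deriv j u x t * space_deriv i (space_deriv j u) x t)))"
proof -
  let ?S = "Q \<inter> (\<lambda>z. space_grad u (fst z) (snd z)) -` (- {0})"
  have S: "?S \<subseteq> Q" by auto
  note c = C21_onD(1,3,4)[OF u, THEN continuous_on_subset, OF S, unfolded case_prod_unfold]
    continuous_on_space_grad[OF u, THEN continuous_on_subset, OF S, unfolded case_prod_unfold]
  have "continuous_on ?S (\<lambda>z. u (fst z) (snd z) powr (p - 1))"
    using nn p by (intro continuous_on_powr' c continuous_on_const) (auto simp: less_eq_real_def)
  moreover have "continuous_on ?S (\<lambda>z. norm (space_grad u (fst z) (snd z)) powr (q - 2))"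
    by (intro continuous_on_powr continuous_on_norm c continuous_on_const) auto
  ultimately show ?thesis
    unfolding case_prod_unfold
    by (intro continuous_on_add continuous_on_mult continuous_on_const continuous_on_sum c)
qed


section \<open>Pointwise algebra at the maximum\<close>

lemma sum_mult_le_norms:
  fixes a b :: "'n::finite \<Rightarrow> real"
  assumes "(\<Sum>i\<in>UNIV. (a i)\<^sup>2) = g\<^sup>2" "(\<Sum>i\<in>UNIV. (b i)\<^sup>2) = d\<^sup>2" "g \<ge> 0" "d \<ge> 0"
  shows "\<bar>\<Sum>i\<in>UNIV. a i * b i\<bar> \<le> g * d"
proof -
  have "(\<Sum>i\<in>UNIV. a i * b i)\<^sup>2 \<le> (g * d)\<^sup>2"
    using Cauchy_Schwarz_ineq_sum[of a b UNIV] assms by (simp add: power_mult_distrib)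
  then show ?thesis using assms abs_le_square_iff[of "\<Sum>i\<in>UNIV. a i * b i" "g * d"] by simp
qed

text \<open>Cauchy-Schwarz on the diagonal, after which the off-diagonal squares are added. For a
  Hessian it reads |Delta u|^2 <= N |D^2 u|^2.\<close>

lemma trace_square_le:
  fixes H :: "'n::finite \<Rightarrow> 'n \<Rightarrow> real"
  shows "(\<Sum>i\<in>UNIV. H i i)\<^sup>2 \<le> CARD('n) * (\<Sum>i\<in>UNIV. \<Sum>j\<in>UNIV. (H i j)\<^sup>2)"
proof -
  have "(\<Sum>i\<in>UNIV. H i i)\<^sup>2 \<le> CARD('n) * (\<Sum>i\<in>UNIV. (H i i)\<^sup>2)"
    using Cauchy_Schwarz_ineq_sum[of "\<lambda>_. 1" "\<lambda>i. H i i" "UNIV :: 'n set"] by simp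
  also have "\<dots> \<le> CARD('n) * (\<Sum>i\<in>UNIV. \<Sum>j\<in>UNIV. (H i j)\<^sup>2)"
    by (intro mult_left_mono sum_mono member_le_sum) auto
  finally show ?thesis .
qed

text \<open>For the weight \<open>1 / b\<close> with \<open>b\<close> affine in \<open>u\<close>, the gradient terms of order \<open>g\<^sup>2 / b\<^sup>2\<close> cancel, and the
  term of order \<open>g powr q / b\<close> keeps the favourable sign because \<open>q > 1\<close>.\<close>

lemma bernstein_algebra:
  fixes v1 D1 G :: "'n::finite \<Rightarrow> real" and H :: "'n \<Rightarrow> 'n \<Rightarrow> real"
  assumes pos: "g > 0" "b > 0" "D > 0" "d \<ge> 0" "m \<ge> 0" "M > 0" "q > 0"
    and g: "(\<Sum>i\<in>UNIV. (v1 i)\<^sup>2) = g\<^sup>2" and d: "(\<Sum>i\<in>UNIV. (D1 i)\<^sup>2) = d\<^sup>2"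
    and first: "\<And>j. 2 * (\<Sum>i\<in>UNIV. v1 i * H i j) / g\<^sup>2 + v1 j / b + m * D1 j / D = 0"
    and G: "\<And>i. G i = p * v powr (p - 1) * v1 i + M * (q * g powr (q - 2) * (\<Sum>j\<in>UNIV. v1 j * H i j))"
    and second: "0 \<le> (2 * (\<Sum>i\<in>UNIV. v1 i * G i) - 2 * (\<Sum>i\<in>UNIV. \<Sum>j\<in>UNIV. (H i j)\<^sup>2)) / g\<^sup>2
        + (\<Sum>j\<in>UNIV. (2 * (\<Sum>i\<in>UNIV. v1 i * H i j) / g\<^sup>2)\<^sup>2)
        + F / b - (\<Sum>j\<in>UNIV. (v1 j / b)\<^sup>2) + m * (L / D + (\<Sum>j\<in>UNIV. (D1 j / D)\<^sup>2))"
    and F: "F = v powr p + M * g powr q" "0 \<le> F" "F \<le> - (\<Sum>i\<in>UNIV. H i i)"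
    and small: "2 * p * v powr (p - 1) + v powr p / b \<le> 2 / CARD('n) * F\<^sup>2 / g\<^sup>2"
  shows "(q - 1) * M * g powr q / b
    \<le> m * (M * q * g powr (q - 1) + 2 * g / b) * (d / D) + (m\<^sup>2 + m) * (d / D)\<^sup>2 + m * (L / D)"
proof -
  \<comment> \<open>\<open>S\<close> pairs the gradients of u and of the cutoff, \<open>A\<close> is
    the logarithmic gradient of w, and \<open>T\<close> is the Hessian applied twice to the
    gradient. The first-order condition expresses both \<open>A\<close> and \<open>T\<close> through
    \<open>S\<close>.\<close>
  define S where "S = (\<Sum>j\<in>UNIV. v1 j * D1 j)"
  define A where "A j = 2 * (\<Sum>i\<in>UNIV. v1 i * H i j) / g\<^sup>2" for j
  define T where "T = (\<Sum>i\<in>UNIV. v1 i * (\<Sum>j\<in>UNIV. v1 j * H i j))"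
  have S: "\<bar>S\<bar> \<le> g * d" unfolding S_def using pos by (intro sum_mult_le_norms g d) auto
  have A: "A j = - (v1 j / b + m / D * D1 j)" for j using first[of j] unfolding A_def by simp
  \<comment> \<open>The leading part g^2 / b^2 of |grad ln w|^2 is exactly the term subtracted in
    \<open>second\<close>.\<close>
  have "(\<Sum>j\<in>UNIV. (A j)\<^sup>2)
      = (\<Sum>j\<in>UNIV. (v1 j)\<^sup>2 * (1 / b\<^sup>2) + (v1 j * D1 j) * (2 * m / (b * D)) + (D1 j)\<^sup>2 * (m / D)\<^sup>2)"
    unfolding A by (intro sum.cong refl) (simp add: power2_eq_square algebra_simps)
  also have "\<dots> = g\<^sup>2 * (1 / b\<^sup>2) + S * (2 * m / (b * D)) + d\<^sup>2 * (m / D)\<^sup>2"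
    unfolding sum.distrib S_def by (simp only: g d flip: sum_distrib_right)
  finally have A2: "(\<Sum>j\<in>UNIV. (A j)\<^sup>2) = g\<^sup>2 / b\<^sup>2 + 2 * m * S / (b * D) + m\<^sup>2 * (d / D)\<^sup>2"
    by (simp add: power_divide power_mult_distrib algebra_simps)
  have v2: "(\<Sum>j\<in>UNIV. (v1 j / b)\<^sup>2) = g\<^sup>2 / b\<^sup>2"
    by (simp add: power_divide g flip: sum_divide_distrib)
  have D2: "(\<Sum>j\<in>UNIV. (D1 j / D)\<^sup>2) = (d / D)\<^sup>2"
    by (simp add: power_divide d flip: sum_divide_distrib)
  \<comment> \<open>The part -g^2 / b found here becomes - q M g^q / b after multiplication by M q
    g^(q-2). Against + M g^q / b from F / b it leaves the dissipation with factor q - 1.\<close>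
  have "T = (\<Sum>j\<in>UNIV. \<Sum>i\<in>UNIV. v1 i * (v1 j * H i j))"
    unfolding T_def sum_distrib_left by (rule sum.swap)
  also have "2 * \<dots> / g\<^sup>2 = (\<Sum>j\<in>UNIV. v1 j * A j)"
    unfolding A_def by (simp add: sum_distrib_left sum_divide_distrib mult_ac)
  also have "\<dots> = (\<Sum>j\<in>UNIV. (v1 j)\<^sup>2 * (- (1 / b)) + (v1 j * D1 j) * (- (m / D)))"
    unfolding A by (intro sum.cong refl) (simp add: power2_eq_square algebra_simps)
  also have "\<dots> = - (g\<^sup>2 / b + m * S / D)"
    unfolding sum.distrib S_def by (simp only: g flip: sum_distrib_right) simp
  finally have T: "2 * T / g\<^sup>2 = - (g\<^sup>2 / b + m * S / D)" .
  have "(\<Sum>i\<in>UNIV. v1 i * G i) = (\<Sum>i\<in>UNIV. (v1 i)\<^sup>2 * (p * v powr (p - 1))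
      + (v1 i * (\<Sum>j\<in>UNIV. v1 j * H i j)) * (M * q * g powr (q - 2)))"
    unfolding G by (intro sum.cong refl) (simp add: power2_eq_square algebra_simps)
  also have "\<dots> = g\<^sup>2 * (p * v powr (p - 1)) + T * (M * q * g powr (q - 2))"
    unfolding sum.distrib T_def by (simp only: g flip: sum_distrib_right)
  finally have G2: "2 * (\<Sum>i\<in>UNIV. v1 i * G i) / g\<^sup>2
      = 2 * p * v powr (p - 1) + M * q * g powr (q - 2) * (2 * T / g\<^sup>2)"
    using pos(1) by (simp add: field_simps)
  have pw: "g powr (q - 2) * g\<^sup>2 = g powr q" "g powr (q - 2) * g = g powr (q - 1)"
    using pos(1) powr_add[of g "q - 2" 2] powr_add[of g "q - 2" 1] by simp_all
  \<comment> \<open>Squaring is monotone here since 0 <= F <= - tr H.\<close>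
  have "F\<^sup>2 \<le> (- (\<Sum>i\<in>UNIV. H i i))\<^sup>2" using F by (intro power_mono)
  also have "\<dots> \<le> CARD('n) * (\<Sum>i\<in>UNIV. \<Sum>j\<in>UNIV. (H i j)\<^sup>2)"
    using trace_square_le[of H] by simp
  finally have "F\<^sup>2 / CARD('n) \<le> (\<Sum>i\<in>UNIV. \<Sum>j\<in>UNIV. (H i j)\<^sup>2)"
    by (simp add: divide_le_eq mult.commute)
  then have H2: "2 / CARD('n) * F\<^sup>2 / g\<^sup>2 \<le> 2 * (\<Sum>i\<in>UNIV. \<Sum>j\<in>UNIV. (H i j)\<^sup>2) / g\<^sup>2"
    by (intro divide_right_mono) auto
  have "0 \<le> 2 * p * v powr (p - 1) + M * q * g powr (q - 2) * (- (g\<^sup>2 / b + m * S / D))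
      - 2 * (\<Sum>i\<in>UNIV. \<Sum>j\<in>UNIV. (H i j)\<^sup>2) / g\<^sup>2 + (2 * m * S / (b * D) + m\<^sup>2 * (d / D)\<^sup>2)
      + F / b + m * (L / D + (d / D)\<^sup>2)"
    using second unfolding A_def[symmetric] diff_divide_distrib A2 v2 D2 G2 T by simp
  also have "M * q * g powr (q - 2) * (- (g\<^sup>2 / b + m * S / D))
      = - (M * q * g powr q / b) - M * q * m * g powr (q - 2) * S / D"
    unfolding pw(1)[symmetric] by (simp add: algebra_simps)
  also have "F / b = v powr p / b + M * g powr q / b" by (simp add: F(1) add_divide_distrib)
  finally have main: "(q - 1) * M * g powr q / b \<le> - (M * q * m * g powr (q - 2) * S / D)
      + 2 * m * S / (b * D) + m\<^sup>2 * (d / D)\<^sup>2 + m * (L / D + (d / D)\<^sup>2)"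
    using H2 small by (simp add: algebra_simps diff_divide_distrib)
  have "- (M * q * m * g powr (q - 2) * S / D) = (M * q * m * g powr (q - 2) / D) * (- S)" by simp
  also have "\<dots> \<le> (M * q * m * g powr (q - 2) / D) * (g * d)"
    using S pos by (intro mult_left_mono) auto
  also have "\<dots> = M * q * m * g powr (q - 1) * (d / D)" unfolding pw(2)[symmetric] by simp
  finally have 1: "- (M * q * m * g powr (q - 2) * S / D) \<le> M * q * m * g powr (q - 1) * (d / D)" .
  have "2 * m * S / (b * D) = (2 * m / (b * D)) * S" by simp
  also have "\<dots> \<le> (2 * m / (b * D)) * (g * d)" using S pos by (intro mult_left_mono) auto
  finally have 2: "2 * m * S / (b * D) \<le> 2 * m * g / b * (d / D)" by simp
  show ?thesis using main 1 2 by (simp add: algebra_simps)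
qed

text \<open>The exponent of \<open>M\<close> in the bound on \<open>u\<close> is the one for which \<open>u powr (p - 1) * g\<^sup>2\<close> is a
  small multiple of the square of the right-hand side, by interpolation between \<open>u powr p\<close> and
  \<open>M * g powr q\<close>.\<close>

lemma zero_order_small:
  fixes p q M c b v g :: real
  assumes pq: "p > 1" "q > 1" "(p + 1) * q < 2 * p" and M: "M > 0" and c: "c > 0" and g: "g > 0"
    and v: "0 \<le> v" "v \<le> c * M powr (2 / (2 * p - (p + 1) * q))" "v \<le> b" "b > 0"
    and small: "(2 * p + 1) * c powr ((2 * p - (p + 1) * q) / q) \<le> k"
  shows "2 * p * v powr (p - 1) + v powr p / b \<le> k * (v powr p + M * g powr q)\<^sup>2 / g\<^sup>2"
proof -
  \<comment> \<open>The exponent left over when v^(p-1) g^2 is split as (v^p)^(2(q-1)/q) v^theta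
    (g^q)^(2/q): the two outer factors have total degree 2 in F, and v^theta supplies the smallness
    together with the factor M^(2/q) that g^q lacks.\<close>
  define \<theta> where "\<theta> = (2 * p - (p + 1) * q) / q"
  have cancel: "2 / e * (e / q) = 2 / q" if "e > 0" for e using that by simp
  have "2 * p - (p + 1) * q > 0" using pq by simp
  then have \<theta>: "\<theta> > 0" "2 / (2 * p - (p + 1) * q) * \<theta> = 2 / q"
    unfolding \<theta>_def using pq by (simp, intro cancel)
  define F where "F = v powr p + M * g powr q"
  have F: "v powr p \<le> F" "M * g powr q \<le> F" "F > 0" using M g by (auto simp: F_def add_nonneg_pos)
  have "v powr \<theta> \<le> (c * M powr (2 / (2 * p - (p + 1) * q))) powr \<theta>"
    using v \<theta> by (intro powr_mono2) auto
  also have "\<dots> = c powr \<theta> * M powr (2 / q)" using c M by (simp only: powr_mult powr_powr \<theta>(2) less_imp_le powr_ge_zero)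
  finally have 1: "v powr \<theta> \<le> c powr \<theta> * M powr (2 / q)" .
  have "p - 1 = p * (2 * (q - 1) / q) + \<theta>" using pq by (simp add: \<theta>_def field_simps)
  then have "v powr (p - 1) = (v powr p) powr (2 * (q - 1) / q) * v powr \<theta>"
    by (simp add: powr_powr powr_add)
  also have "\<dots> \<le> F powr (2 * (q - 1) / q) * (c powr \<theta> * M powr (2 / q))"
    using pq F 1 by (intro mult_mono powr_mono2) auto
  finally have "v powr (p - 1) * g\<^sup>2 \<le> F powr (2 * (q - 1) / q) * (c powr \<theta> * M powr (2 / q)) * g\<^sup>2"
    by (intro mult_right_mono) auto
  also have "\<dots> = c powr \<theta> * F powr (2 * (q - 1) / q) * (M powr (2 / q) * g\<^sup>2)" by simp
  also have "M powr (2 / q) * g\<^sup>2 = (M * g powr q) powr (2 / q)"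
    using M g pq by (simp add: powr_mult powr_powr)
  also have "c powr \<theta> * F powr (2 * (q - 1) / q) * (M * g powr q) powr (2 / q)
      \<le> c powr \<theta> * F powr (2 * (q - 1) / q) * F powr (2 / q)"
    using M g pq F by (intro mult_left_mono powr_mono2) auto
  also have "\<dots> = c powr \<theta> * F powr (2 * (q - 1) / q + 2 / q)" by (simp add: powr_add)
  also have "2 * (q - 1) / q + 2 / q = 2" using pq by (simp add: field_simps)
  finally have 2: "v powr (p - 1) * g\<^sup>2 \<le> c powr \<theta> * F\<^sup>2" using F by simp
  \<comment> \<open>The term v^p / b coming from the weight is of the same size as the reaction
    term; it accounts for the 1 in 2 p + 1.\<close>
  have "v powr p = v * v powr (p - 1)" using v(1) powr_add[of v 1 "p - 1"] by simp
  also have "\<dots> \<le> b * v powr (p - 1)" using v by (intro mult_right_mono) auto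
  finally have "v powr p / b \<le> v powr (p - 1)" using v by (simp add: divide_le_eq mult.commute)
  then have "(2 * p * v powr (p - 1) + v powr p / b) * g\<^sup>2 \<le> (2 * p + 1) * v powr (p - 1) * g\<^sup>2"
    by (intro mult_right_mono) (auto simp: algebra_simps)
  also have "\<dots> \<le> (2 * p + 1) * (c powr \<theta> * F\<^sup>2)"
    using 2 pq by (simp add: mult.assoc)
  also have "\<dots> = (2 * p + 1) * c powr \<theta> * F\<^sup>2" by simp
  also have "\<dots> \<le> k * F\<^sup>2" using small unfolding \<theta>_def by (intro mult_right_mono) auto
  finally show ?thesis using g unfolding F_def by (simp add: pos_le_divide_eq)
qed

section \<open>From the inequality at the maximum to a gradient bound\<close>

lemma powr_between:
  fixes X :: real
  assumes "X > 0" "a \<le> b" "b \<le> c"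
  shows "X powr b \<le> X powr a + X powr c"
proof (cases "X \<le> 1")
  case True
  then have "X powr b \<le> X powr a" using assms by (intro powr_mono') auto
  then show ?thesis by (simp add: add_increasing2)
next
  case False
  then have "X powr b \<le> X powr c" using assms by (intro powr_mono) auto
  then show ?thesis by (simp add: add_increasing)
qed

text \<open>One of the four terms on the right must be at least a quarter of g^q, hence the 4 K;
  each case is solved for g separately.\<close>

lemma gradient_bound_from_inequality:
  fixes g q K X Y :: real
  assumes q: "1 < q" "q < 2" and pos: "g > 0" "K > 0" "X > 0" "Y > 0"
    and ineq: "g powr q \<le> K * ((g powr (q - 1) + g) * X + X\<^sup>2 + Y)"
  shows "g \<le> 2 * (4 * K + (4 * K) powr (1 / (q - 1)) + (4 * K) powr (1 / q))
    * (X + X powr (1 / (q - 1)) + Y powr (1 / q))"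
proof -
  let ?k = "4 * K" and ?C = "4 * K + (4 * K) powr (1 / (q - 1)) + (4 * K) powr (1 / q)"
  let ?Z = "X + X powr (1 / (q - 1)) + Y powr (1 / q)"
  have root: "g \<le> A powr (1 / e)" if "g powr e \<le> A" "e > 0" for A e
  proof -
    have "(g powr e) powr (1 / e) \<le> A powr (1 / e)" using that pos by (intro powr_mono2) auto
    then show ?thesis using pos that by (simp add: powr_powr)
  qed
  have C: "?k \<le> ?C" "?k powr (1 / (q - 1)) \<le> ?C" "?k powr (1 / q) \<le> ?C" "0 \<le> ?C"
    using pos by (auto simp: add_nonneg_nonneg)
  have Z: "X \<le> ?Z" "X powr (1 / (q - 1)) \<le> ?Z" "Y powr (1 / q) \<le> ?Z" "0 \<le> ?Z"
    using pos by (auto simp: add_nonneg_nonneg)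
  have s: "g powr q = g powr (q - 1) * g" using pos powr_add[of g "q - 1" 1] by simp
  consider "g powr q \<le> ?k * (g powr (q - 1) * X)" | "g powr q \<le> ?k * (g * X)"
    | "g powr q \<le> ?k * X\<^sup>2" | "g powr q \<le> ?k * Y"
    using ineq by (force simp: algebra_simps)
  then have "g \<le> ?C * (2 * ?Z)"
  proof cases
    case 1
    then have "g powr (q - 1) * g \<le> g powr (q - 1) * (?k * X)" unfolding s by (simp add: mult_ac)
    then have "g \<le> ?k * X" using pos by simp
    also have "\<dots> \<le> ?C * (2 * ?Z)" using C Z pos by (intro mult_mono) auto
    finally show ?thesis .
  next
    case 2
    then have "g powr (q - 1) \<le> ?k * X" using pos unfolding s by simp
    then have "g \<le> (?k * X) powr (1 / (q - 1))" using q by (intro root) auto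
    also have "\<dots> = ?k powr (1 / (q - 1)) * X powr (1 / (q - 1))" using pos by (simp add: powr_mult)
    also have "\<dots> \<le> ?C * (2 * ?Z)" using C Z pos by (intro mult_mono) auto
    finally show ?thesis .
  next
    case 3
    then have "g \<le> (?k * X\<^sup>2) powr (1 / q)" using q by (intro root) auto
    also have "\<dots> = ?k powr (1 / q) * X powr (2 / q)"
      using pos by (simp add: powr_mult powr_powr flip: powr_numeral)
    also have "\<dots> \<le> ?C * (2 * ?Z)"
    proof (intro mult_mono C)
      \<comment> \<open>1 <= 2 / q <= 1 / (q - 1) because q <= 2.\<close>
      have "X powr (2 / q) \<le> X powr 1 + X powr (1 / (q - 1))"
        using q pos by (intro powr_between) (auto simp: field_simps)
      also have "\<dots> \<le> 2 * ?Z" using Z pos by simp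
      finally show "X powr (2 / q) \<le> 2 * ?Z" .
    qed auto
    finally show ?thesis .
  next
    case 4
    then have "g \<le> (?k * Y) powr (1 / q)" using q by (intro root) auto
    also have "\<dots> = ?k powr (1 / q) * Y powr (1 / q)" using pos by (simp add: powr_mult)
    also have "\<dots> \<le> ?C * (2 * ?Z)" using C Z pos by (intro mult_mono) auto
    finally show ?thesis .
  qed
  then show ?thesis by (simp only: mult_ac)
qed

text \<open>The bound at the maximum point involves negative powers of D. A factor D^k with k at
  least their exponent removes them, as D <= 1 and k - a >= 0; this fixes the size of k.\<close>

lemma cutoff_power_le:
  fixes D r a :: real
  assumes "0 < D" "D \<le> 1" "r > 0" "a \<le> real k"
  shows "D ^ k * (1 / (r * D)) powr a \<le> r powr (- a)"
proof -
  have "D ^ k * (1 / (r * D)) powr a = r powr (- a) * D powr (real k - a)"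
    using assms by (simp add: powr_divide powr_mult powr_minus powr_diff powr_realpow field_simps)
  also have "\<dots> \<le> r powr (- a) * 1"
    using assms by (intro mult_left_mono powr_le1) auto
  finally show ?thesis by simp
qed


text \<open>Multiplying by b cancels the 1 / b in the dissipation and in 2 g / b; elsewhere b <= 2 U
  is used. With X = 1 / (r D) and Y = 1 / (sigma D), the cutoff terms obey d / D <= 2 X and L / D <=
  Y + 2 N X^2.\<close>

lemma absorb_coefficients:
  fixes g b U D d L r \<sigma> q M m N :: real
  assumes pos: "g > 0" "b > 0" "b \<le> 2 * U" "0 < D" "D \<le> 1" "r > 0" "\<sigma> > 0" "m \<ge> 0" "M > 0" "q > 1" "N \<ge> 0"
    and d: "0 \<le> d" "d \<le> 2 / r" and L: "L \<le> 1 / \<sigma> + 2 * N / r\<^sup>2"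
    and ineq: "(q - 1) * M * g powr q / b
      \<le> m * (M * q * g powr (q - 1) + 2 * g / b) * (d / D) + (m\<^sup>2 + m) * (d / D)\<^sup>2 + m * (L / D)"
  shows "g powr q \<le> (4 * U * m * M * q + 4 * m + 8 * U * (m\<^sup>2 + m) + 4 * U * m * N + 2 * U * m)
      / ((q - 1) * M) * ((g powr (q - 1) + g) * (1 / (r * D)) + (1 / (r * D))\<^sup>2 + 1 / (\<sigma> * D))"
proof -
  define X Y where "X = 1 / (r * D)" and "Y = 1 / (\<sigma> * D)"
  let ?h = "g powr (q - 1)"
  let ?S = "(?h + g) * X + X\<^sup>2 + Y"
  have XY: "X > 0" "Y > 0" and h: "?h > 0" using pos by (auto simp: X_def Y_def)
  have U: "U > 0" using pos by simp
  have dX: "0 \<le> d / D" "d / D \<le> 2 * X"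
    using d pos divide_right_mono[OF d(2), of D] by (auto simp: X_def)
  have "L / D \<le> (1 / \<sigma> + 2 * N / r\<^sup>2) / D" using L pos by (intro divide_right_mono) auto
  also have "\<dots> = Y + 2 * N * (X\<^sup>2 * D)"
    using pos by (simp add: X_def Y_def field_simps power2_eq_square)
  \<comment> \<open>The part of L of order r^(-2) is divided by D only once; D <= 1 allows the
    second division that makes it a multiple of X^2.\<close>
  also have "\<dots> \<le> Y + 2 * N * (X\<^sup>2 * 1)"
    using pos by (intro add_left_mono mult_left_mono) auto
  finally have LX: "L / D \<le> Y + 2 * N * X\<^sup>2" by simp
  have coef: "0 \<le> m * (M * q * ?h + 2 * g / b)"
    using pos h by (intro mult_nonneg_nonneg add_nonneg_nonneg divide_nonneg_pos) auto
  have "(q - 1) * M * g powr q = b * ((q - 1) * M * g powr q / b)" using pos by simp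
  also have "\<dots> \<le> b * (m * (M * q * ?h + 2 * g / b) * (d / D) + (m\<^sup>2 + m) * (d / D)\<^sup>2 + m * (L / D))"
    using ineq pos by (intro mult_left_mono) auto
  also have "\<dots> \<le> b * (m * (M * q * ?h + 2 * g / b) * (2 * X) + (m\<^sup>2 + m) * (2 * X)\<^sup>2 + m * (Y + 2 * N * X\<^sup>2))"
    using pos dX LX coef by (intro mult_left_mono add_mono power_mono) auto
  also have "\<dots> = b * (2 * m * M * q * ?h * X + 4 * (m\<^sup>2 + m) * X\<^sup>2 + m * (Y + 2 * N * X\<^sup>2)) + 4 * m * g * X"
    using pos by (simp add: field_simps power2_eq_square)
  also have "\<dots> \<le> 2 * U * (2 * m * M * q * ?h * X + 4 * (m\<^sup>2 + m) * X\<^sup>2 + m * (Y + 2 * N * X\<^sup>2)) + 4 * m * g * X"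
    using pos XY h by (intro add_right_mono mult_right_mono) auto
  also have "\<dots> = 4 * U * m * M * q * (?h * X) + 4 * m * (g * X) + 8 * U * (m\<^sup>2 + m) * X\<^sup>2
      + 4 * U * m * N * X\<^sup>2 + 2 * U * m * Y" by (simp add: algebra_simps)
  also have "\<dots> \<le> 4 * U * m * M * q * ?S + 4 * m * ?S + 8 * U * (m\<^sup>2 + m) * ?S
      + 4 * U * m * N * ?S + 2 * U * m * ?S"
  proof -
    have "0 \<le> ?h * X" "0 \<le> g * X" "0 \<le> X\<^sup>2" using XY h pos by auto
    then have "?h * X \<le> ?S" "g * X \<le> ?S" "X\<^sup>2 \<le> ?S" "Y \<le> ?S"
      using XY by (auto simp: distrib_right)
    then show ?thesis using pos U by (intro add_mono mult_left_mono) auto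
  qed
  finally have "(q - 1) * M * g powr q
      \<le> (4 * U * m * M * q + 4 * m + 8 * U * (m\<^sup>2 + m) + 4 * U * m * N + 2 * U * m) * ?S"
    by (simp only: distrib_right)
  then show ?thesis using pos unfolding X_def Y_def by (simp add: pos_le_divide_eq mult_ac)
qed

section \<open>The estimate at the top centre of a cylinder, and its scaling\<close>

lemma gradient_estimate_center:
  fixes u :: "real ^ 'n \<Rightarrow> real \<Rightarrow> real" and p q M c r \<sigma> t U m K :: real and k :: nat
  defines "U \<equiv> c * M powr (2 / (2 * p - (p + 1) * q))" and "m \<equiv> 2 * real k"
  defines "K \<equiv> (4 * U * m * M * q + 4 * m + 8 * U * (m\<^sup>2 + m) + 4 * U * m * CARD('n) + 2 * U * m)
      / ((q - 1) * M)"
  assumes pq: "p > 1" "1 < q" "(p + 1) * q < 2 * p" "q < 2" and M: "M > 0" and c: "c > 0"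
    and small: "(2 * p + 1) * c powr ((2 * p - (p + 1) * q) / q) \<le> 2 / CARD('n)"
    and Q: "open Q" and sol: "nonneg_classical_solution p q M Q u"
    and bound: "\<And>x t. (x, t) \<in> Q \<Longrightarrow> u x t \<le> U \<and> time_deriv u x t \<le> 0"
    and r: "r > 0" and \<sigma>: "\<sigma> > 0" and sub: "cball z r \<times> {t - \<sigma>..t} \<subseteq> Q"
    and k: "1 / (q - 1) \<le> k"
  shows "norm (space_grad u z t)
    \<le> 4 * (4 * K + (4 * K) powr (1 / (q - 1)) + (4 * K) powr (1 / q))
      * (r powr (- 1) + r powr (- (1 / (q - 1))) + \<sigma> powr (- (1 / q)))"
\<comment> \<open>The maximum argument has to start at a point with nonzero gradient; otherwise only
  the sign of the right-hand side is at stake.\<close>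
proof (cases "space_grad u z t = 0")
  case True
  have "U > 0" using c M by (simp add: U_def)
  then have "K \<ge> 0" using pq M by (auto simp: K_def m_def intro!: divide_nonneg_pos add_nonneg_nonneg)
  then show ?thesis using True by (auto intro!: mult_nonneg_nonneg add_nonneg_nonneg)
next
  case False
  have U: "U > 0" using c M by (simp add: U_def)
  have u: "C21_on Q u" and nn: "\<And>x t. (x, t) \<in> Q \<Longrightarrow> 0 \<le> u x t"
    and eq: "\<And>x t. (x, t) \<in> Q \<Longrightarrow> time_deriv u x t - space_laplacian u x t
        = u x t powr p + M * norm (space_grad u x t) powr q"
    using sol unfolding nonneg_classical_solution_def by auto
  have "1 < 1 / (q - 1)" using pq by simp
  then have k1: "1 < real k" using k by linarith
  then have m0: "m > 0" by (simp add: m_def)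
  let ?D = "barrier z r (t - \<sigma>) \<sigma>" and ?K = "cball z r \<times> {t - \<sigma>..t}"
  have K0: "K > 0" using pq M U m0
    by (auto simp: K_def intro!: divide_pos_pos add_nonneg_pos add_nonneg_nonneg)
  have Kx: "norm (x - z) \<le> r \<and> t - \<sigma> \<le> s \<and> s \<le> t - \<sigma> + \<sigma>" if "(x, s) \<in> ?K" for x s
    using that by (auto simp: dist_norm norm_minus_commute)
  have intr: "\<exists>d>0. ball x d \<times> {s - d<..s} \<subseteq> ?K" if "(x, s) \<in> ?K" "?D x s > 0" for x s
  proof -
    from Kx[OF that(1)] have le: "norm (x - z) \<le> r" "t - \<sigma> \<le> s" by auto
    \<comment> \<open>The cutoff vanishes on the sphere and at the initial time, so where it is
      positive both are excluded; the final time is not.\<close>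
    have "norm (x - z) \<noteq> r" "s \<noteq> t - \<sigma>" using that(2) r by (auto simp: barrier_def)
    with le have lt: "dist z x < r" "t - \<sigma> < s" by (auto simp: dist_norm norm_minus_commute)
    show ?thesis
    proof (intro exI conjI)
      show "min (r - dist z x) (s - (t - \<sigma>)) > 0" using lt by simp
      show "ball x (min (r - dist z x) (s - (t - \<sigma>))) \<times> {s - min (r - dist z x) (s - (t - \<sigma>))<..s} \<subseteq> ?K"
      proof (intro Sigma_mono subsetI)
        fix y assume "y \<in> ball x (min (r - dist z x) (s - (t - \<sigma>)))"
        then show "y \<in> cball z r" using dist_triangle[of z y x] by simp
      qed (use that(1) in auto)
    qed
  qed
  have zt: "(z, t) \<in> ?K" using r \<sigma> by simp
  have Dzt: "?D z t = 1" using \<sigma> by (simp add: barrier_def)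
  have uA: "u x s < 2 * U" if "(x, s) \<in> ?K" for x s using bound[of x s] that sub U by fastforce
  have cpt: "compact ?K" by (intro compact_Times compact_cball compact_Icc)
  have rs: "r \<noteq> 0" "\<sigma> \<noteq> 0" using r \<sigma> by auto
  have Dnn: "?D x s \<ge> 0" if "(x, s) \<in> ?K" for x s
    using barrier_bounds(1)[OF r \<sigma>] Kx[OF that] by blast
  have Dpos: "?D z t > 0" and k2: "2 * k > 0" using k1 by (simp_all add: Dzt)
  obtain y \<tau> where y: "(y, \<tau>) \<in> ?K" "?D y \<tau> > 0" "space_grad u y \<tau> \<noteq> 0"
    and le: "(norm (space_grad u z t))\<^sup>2 * ?D z t ^ (2 * k) / (2 * U - u z t)
      \<le> (norm (space_grad u y \<tau>))\<^sup>2 * ?D y \<tau> ^ (2 * k) / (2 * U - u y \<tau>)"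
    and first: "\<forall>j. 2 * (\<Sum>i\<in>UNIV. space_deriv i u y \<tau> * space_deriv i (space_deriv j u) y \<tau>)
        / (norm (space_grad u y \<tau>))\<^sup>2 + space_deriv j u y \<tau> / (2 * U - u y \<tau>)
      + real (2 * k) * space_deriv j ?D y \<tau> / ?D y \<tau> = 0"
    and second: "0 \<le> (2 * (\<Sum>i\<in>UNIV. space_deriv i u y \<tau> *
            (p * u y \<tau> powr (p - 1) * space_deriv i u y \<tau>
            + M * (q * norm (space_grad u y \<tau>) powr (q - 2)
              * (\<Sum>j\<in>UNIV. space_deriv j u y \<tau> * space_deriv i (space_deriv j u) y \<tau>))))
          - 2 * (\<Sum>i\<in>UNIV. \<Sum>j\<in>UNIV. (space_deriv i (space_deriv j u) y \<tau>)\<^sup>2))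
            / (norm (space_grad u y \<tau>))\<^sup>2
        + (\<Sum>j\<in>UNIV. (2 * (\<Sum>i\<in>UNIV. space_deriv i u y \<tau> * space_deriv i (space_deriv j u) y \<tau>)
            / (norm (space_grad u y \<tau>))\<^sup>2)\<^sup>2)
        + (u y \<tau> powr p + M * norm (space_grad u y \<tau>) powr q) / (2 * U - u y \<tau>)
        - (\<Sum>j\<in>UNIV. (space_deriv j u y \<tau> / (2 * U - u y \<tau>))\<^sup>2)
        + real (2 * k) * ((time_deriv ?D y \<tau> - space_laplacian ?D y \<tau>) / ?D y \<tau>
          + (\<Sum>j\<in>UNIV. (space_deriv j ?D y \<tau> / ?D y \<tau>)\<^sup>2))"
    by (rule bernstein_limit[OF Q u C21_on_barrier[OF rs] eq DERIV_reaction[OF Q u nn pq(1)]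
        continuous_on_reaction_deriv[OF u nn pq(1)] cpt sub intr Dnn uA zt Dpos False k2])
  define g b D d L where "g = norm (space_grad u y \<tau>)" and "b = 2 * U - u y \<tau>" and "D = ?D y \<tau>"
    and "d = sqrt (\<Sum>j\<in>UNIV. (space_deriv j ?D y \<tau>)\<^sup>2)"
    and "L = time_deriv ?D y \<tau> - space_laplacian ?D y \<tau>"
  note defs = g_def[symmetric] b_def[symmetric] D_def[symmetric] L_def[symmetric]
  have yQ: "(y, \<tau>) \<in> Q" using y(1) sub by blast
  have v: "0 \<le> u y \<tau>" "u y \<tau> \<le> U" using nn[OF yQ] bound[OF yQ] by auto
  have b: "b > 0" "U \<le> b" "b \<le> 2 * U" "u y \<tau> \<le> b" using v U by (auto simp: b_def)
  have g: "g > 0" and g2: "(\<Sum>i\<in>UNIV. (space_deriv i u y \<tau>)\<^sup>2) = g\<^sup>2"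
    using y(3) by (auto simp: g_def norm_space_grad)
  have d2: "(\<Sum>i\<in>UNIV. (space_deriv i ?D y \<tau>)\<^sup>2) = d\<^sup>2" and d0: "d \<ge> 0"
    by (auto simp: d_def sum_nonneg)
  note bb = barrier_bounds[OF r \<sigma>, of y z "t - \<sigma>" \<tau>]
  have bk: "norm (y - z) \<le> r" "t - \<sigma> \<le> \<tau>" "\<tau> \<le> t - \<sigma> + \<sigma>" using Kx[OF y(1)] by auto
  have D: "0 < D" "D \<le> 1" using y(2) bb(2)[OF bk] by (auto simp: D_def)
  have d: "d \<le> 2 / r" unfolding d_def
    using real_sqrt_le_mono[OF bb(3)[OF bk]] r by simp
  have L: "L \<le> 1 / \<sigma> + 2 * real CARD('n) / r\<^sup>2" using bb(4)[OF bk] by (simp add: L_def)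
  \<comment> \<open>Here u_t <= 0 enters: the equation gives F = u_t - Delta u <= - Delta u.\<close>
  have tr: "u y \<tau> powr p + M * g powr q \<le> - (\<Sum>i\<in>UNIV. space_deriv i (space_deriv i u) y \<tau>)"
    using eq[OF yQ] bound[OF yQ] by (simp add: g_def space_laplacian_def)
  have F0: "0 \<le> u y \<tau> powr p + M * g powr q" using M by simp
  have sm: "2 * p * u y \<tau> powr (p - 1) + u y \<tau> powr p / b
      \<le> 2 / real CARD('n) * (u y \<tau> powr p + M * g powr q)\<^sup>2 / g\<^sup>2"
    by (rule zero_order_small[OF pq(1,2,3) M c g v(1) v(2)[unfolded U_def] b(4,1) small])
  have m': "real (2 * k) = m" by (simp add: m_def)
  have "(q - 1) * M * g powr q / b
      \<le> m * (M * q * g powr (q - 1) + 2 * g / b) * (d / D) + (m\<^sup>2 + m) * (d / D)\<^sup>2 + m * (L / D)"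
    using bernstein_algebra[OF g b(1) D(1) d0 less_imp_le[OF m0] M _ g2 d2
        first[unfolded defs m', rule_format] refl second[unfolded defs m'] refl F0 tr sm] pq by simp
  then have "g powr q \<le> K * ((g powr (q - 1) + g) * (1 / (r * D)) + (1 / (r * D))\<^sup>2 + 1 / (\<sigma> * D))"
    unfolding K_def
    by (rule absorb_coefficients[OF g b(1,3) D r \<sigma> less_imp_le[OF m0] M pq(2) of_nat_0_le_iff d0 d L])
  then have "g \<le> 2 * (4 * K + (4 * K) powr (1 / (q - 1)) + (4 * K) powr (1 / q))
      * (1 / (r * D) + (1 / (r * D)) powr (1 / (q - 1)) + (1 / (\<sigma> * D)) powr (1 / q))" (is "_ \<le> 2 * ?C * ?Z")
    using g K0 r \<sigma> D pq by (intro gradient_bound_from_inequality) auto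
  then have "D ^ k * g \<le> D ^ k * (2 * ?C * ?Z)" using D by (intro mult_left_mono) auto
  also have "\<dots> = 2 * ?C * (D ^ k * (1 / (r * D)) powr 1 + D ^ k * (1 / (r * D)) powr (1 / (q - 1))
      + D ^ k * (1 / (\<sigma> * D)) powr (1 / q))" using r D by (simp add: algebra_simps)
  also have "\<dots> \<le> 2 * ?C * (r powr (- 1) + r powr (- (1 / (q - 1))) + \<sigma> powr (- (1 / q)))"
  proof (intro mult_left_mono add_mono cutoff_power_le D r \<sigma> k)
    show "1 \<le> real k" using k1 by simp
    have "1 / q \<le> 1" using pq by simp
    then show "1 / q \<le> real k" using k1 by linarith
    show "0 \<le> 2 * ?C" using K0 by (auto intro!: add_nonneg_nonneg)
  qed
  finally have fin: "D ^ k * g \<le> 2 * ?C * (r powr (- 1) + r powr (- (1 / (q - 1))) + \<sigma> powr (- (1 / q)))" .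
  \<comment> \<open>The maximal value is compared with the value at \<open>(z, t)\<close>, where the
    cutoff is 1. Since b lies between U and 2 U, the squares differ by a factor of at most 2, which
    is rounded up to 4 before taking roots; with the earlier 2 this gives the constant 4 of the
    claim.\<close>
  have b0: "0 < 2 * U - u z t" "2 * U - u z t \<le> 2 * U"
    using nn[of z t] bound[of z t] zt sub U by fastforce+
  have "(norm (space_grad u z t))\<^sup>2 / (2 * U) \<le> (norm (space_grad u z t))\<^sup>2 / (2 * U - u z t)"
    using b0 by (intro divide_left_mono) auto
  also have "\<dots> \<le> g\<^sup>2 * D ^ (2 * k) / b" using le by (simp add: Dzt g_def D_def b_def)
  also have "\<dots> \<le> g\<^sup>2 * D ^ (2 * k) / U" using b U D by (intro divide_left_mono) auto
  also have "\<dots> = (D ^ k * g)\<^sup>2 / U" by (simp add: power_mult_distrib mult.commute flip: power_mult)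
  finally have "(norm (space_grad u z t))\<^sup>2 \<le> 2 * (D ^ k * g)\<^sup>2" using U by (simp add: field_simps)
  also have "\<dots> \<le> (2 * (D ^ k * g))\<^sup>2" by (simp add: power_mult_distrib)
  finally have "norm (space_grad u z t) \<le> 2 * (D ^ k * g)"
    by (rule power2_le_imp_le) (use D g in simp)
  with fin show ?thesis by linarith
qed

theorem theorem1p1:
  fixes p q :: real
  assumes "p > 1" and "1 < q" and "q < 2 * p / (p + 1)"
  shows "\<exists>c>0. \<forall>M>0. \<exists>C>0.
    \<forall>(x0 :: real ^ 'n) (R :: real) (T :: real) (u :: real ^ 'n \<Rightarrow> real \<Rightarrow> real).
      R > 0 \<longrightarrow> T > 0 \<longrightarrow>
      nonneg_classical_solution p q M (cylinder x0 R T) u \<longrightarrow>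
      (\<forall>(x, t)\<in>cylinder x0 R T.
          u x t \<le> c * M powr (2 / (2 * p - (p + 1) * q)) \<and> time_deriv u x t \<le> 0) \<longrightarrow>
      (\<forall>(x, t)\<in>cylinder x0 (R / 2) T.
          norm (space_grad u x t)
            \<le> C * (R powr (-1) + R powr (- (1 / (q - 1))) + t powr (- (1 / q))))"
proof -
  have pq: "(p + 1) * q < 2 * p" using assms by (simp add: field_simps)
  have "2 * p / (p + 1) < 2" using assms(1) by (simp add: field_simps)
  then have q2: "q < 2" using assms(3) by linarith
  let ?\<theta> = "(2 * p - (p + 1) * q) / q"
  have \<theta>: "?\<theta> > 0" using pq assms by simp
  \<comment> \<open>Chosen to turn the smallness condition (2 p + 1) c^theta <= 2 / N into an
    equality.\<close>
  define c where "c = (2 / CARD('n) / (2 * p + 1)) powr (1 / ?\<theta>)"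
  have c: "c > 0" using assms(1) by (simp add: c_def)
  have "(a powr (1 / s)) powr s = a" if "a > 0" "s > 0" for a s :: real
    using that by (simp add: powr_powr)
  then have c\<theta>: "c powr ?\<theta> = 2 / CARD('n) / (2 * p + 1)"
    unfolding c_def by this (use \<theta> assms(1) in simp_all)
  have small: "(2 * p + 1) * c powr ?\<theta> \<le> 2 / CARD('n)"
    unfolding c\<theta> using assms(1) by (simp add: divide_simps)
  \<comment> \<open>\<open>k\<close> depends on q alone, so the constants built from it below depend
    only on N, M, p and q.\<close>
  obtain k :: nat where k: "1 / (q - 1) \<le> k" using real_arch_simple by blast
  show ?thesis
  proof (rule exI[of _ c], intro conjI c allI impI)
    fix M :: real assume M: "M > 0"
    define U where "U = c * M powr (2 / (2 * p - (p + 1) * q))"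
    define m where "m = 2 * real k"
    define K where "K = (4 * U * m * M * q + 4 * m + 8 * U * (m\<^sup>2 + m) + 4 * U * m * CARD('n) + 2 * U * m)
      / ((q - 1) * M)"
    define C0 where "C0 = 4 * (4 * K + (4 * K) powr (1 / (q - 1)) + (4 * K) powr (1 / q))"
    have U: "U > 0" using c M by (simp add: U_def)
    have "0 < 1 / (q - 1)" using assms by simp
    then have "0 < real k" using k by linarith
    then have "m > 0" by (simp add: m_def)
    then have "K > 0" using assms M U
      by (auto simp: K_def intro!: divide_pos_pos add_nonneg_pos add_nonneg_nonneg)
    then have C0: "C0 > 0" by (auto simp: C0_def intro!: add_pos_nonneg)
    show "\<exists>C>0. \<forall>(x0 :: real ^ 'n) (R :: real) (T :: real) (u :: real ^ 'n \<Rightarrow> real \<Rightarrow> real).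
      R > 0 \<longrightarrow> T > 0 \<longrightarrow>
      nonneg_classical_solution p q M (cylinder x0 R T) u \<longrightarrow>
      (\<forall>(x, t)\<in>cylinder x0 R T.
          u x t \<le> c * M powr (2 / (2 * p - (p + 1) * q)) \<and> time_deriv u x t \<le> 0) \<longrightarrow>
      (\<forall>(x, t)\<in>cylinder x0 (R / 2) T.
          norm (space_grad u x t)
            \<le> C * (R powr (-1) + R powr (- (1 / (q - 1))) + t powr (- (1 / q))))"
    \<comment> \<open>The local cylinder will have radius R / 4 and length t / 2. Undoing these
      divisions costs at most 4^(1/(q-1)), because 1 / (q - 1) is the largest of the three
      exponents.\<close>
    proof (intro exI[of _ "C0 * 4 powr (1 / (q - 1))"] conjI allI impI)
      show "C0 * 4 powr (1 / (q - 1)) > 0" using C0 by simp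
    next
      fix x0 :: "real ^ 'n" and R T :: real and u :: "real ^ 'n \<Rightarrow> real \<Rightarrow> real"
      assume R: "R > 0" and sol: "nonneg_classical_solution p q M (cylinder x0 R T) u"
        and bound: "\<forall>(x, t)\<in>cylinder x0 R T.
          u x t \<le> c * M powr (2 / (2 * p - (p + 1) * q)) \<and> time_deriv u x t \<le> 0"
      have "norm (space_grad u x t) \<le> C0 * 4 powr (1 / (q - 1))
          * (R powr (- 1) + R powr (- (1 / (q - 1))) + t powr (- (1 / q)))"
        if "(x, t) \<in> cylinder x0 (R / 2) T" for x t
      proof -
        from that have x: "dist x0 x < R / 2" and t: "0 < t" "t < T" by (auto simp: cylinder_def)
      \<comment> \<open>Radius R / 4 keeps the ball around a point of the half ball inside the full
        one, and starting at t / 2 keeps the closed time interval away from 0.\<close>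
      have sub: "cball x (R / 4) \<times> {t - t / 2..t} \<subseteq> cylinder x0 R T"
      proof (clarify)
        fix y s assume y: "y \<in> cball x (R / 4)" "s \<in> {t - t / 2..t}"
        then have "dist x0 y < R" using dist_triangle[of x0 y x] x R by simp
        then show "(y, s) \<in> cylinder x0 R T" using y t by (auto simp: cylinder_def)
      qed
      have "open (cylinder x0 R T)" unfolding cylinder_def by (intro open_Times) auto
      then have "norm (space_grad u x t)
          \<le> C0 * ((R / 4) powr (- 1) + (R / 4) powr (- (1 / (q - 1))) + (t / 2) powr (- (1 / q)))"
        unfolding C0_def K_def m_def U_def
        using R sol bound t
        by (intro gradient_estimate_center[OF assms(1,2) pq q2 M c small _ _ _ _ _ sub k]) auto
      also have "\<dots> \<le> C0 * (4 powr (1 / (q - 1)) * R powr (- 1)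
          + 4 powr (1 / (q - 1)) * R powr (- (1 / (q - 1))) + 4 powr (1 / (q - 1)) * t powr (- (1 / q)))"
      proof -
        have scale: "(X / A) powr (- a) \<le> 4 powr (1 / (q - 1)) * X powr (- a)"
          if "X > 0" "0 < A" "A \<le> 4" "0 \<le> a" "a \<le> 1 / (q - 1)" for X A a :: real
        proof -
          have "(X / A) powr (- a) = A powr a * X powr (- a)"
            using that by (simp add: powr_divide powr_minus field_simps)
          moreover have "A powr a \<le> 4 powr a" using that by (intro powr_mono2) auto
          moreover have "(4::real) powr a \<le> 4 powr (1 / (q - 1))" by (rule powr_mono[OF that(5)]) simp
          ultimately show ?thesis by (metis mult_right_mono order_trans powr_ge_zero)
        qed
        have "1 / q \<le> 1 / (q - 1)" using assms by (intro divide_left_mono) auto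
        then show ?thesis using C0 R t assms q2
          by (intro mult_left_mono add_mono scale) auto
      qed
      also have "\<dots> = C0 * 4 powr (1 / (q - 1))
          * (R powr (- 1) + R powr (- (1 / (q - 1))) + t powr (- (1 / q)))"
        by (simp add: algebra_simps)
      finally show ?thesis .
      qed
      then show "\<forall>(x, t)\<in>cylinder x0 (R / 2) T. norm (space_grad u x t) \<le> C0 * 4 powr (1 / (q - 1))
          * (R powr (- 1) + R powr (- (1 / (q - 1))) + t powr (- (1 / q)))"
        by blast
    qed
  qed
qed

end
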